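(* There exist absolute constants $c_0>0$ and $c_1>0$ with the following property. Fix any dimension $d\ge1$ and any $d$-dimensional exponential family $(\nu,\phi,\Gamma)$, $\{P_\gamma\}_{\gamma\in\Gamma}$, on a measurable space $\mathcal X$ such that (1) $\Gamma\subset\mathbb R^d$ is open and convex and $C(\gamma)<\infty$ for all $\gamma\in\Gamma$; (2) for some $\gamma_0\in\Gamma$, $\mathrm{Var}_{X\sim P_{\gamma_0}}(\langle\phi(X),a\rangle)>0$ for all $a\in\mathbb R^d\setminus\{0\}$. Consider the subfamily corresponding to mean parameters $\mu\in M_0\subset M=\mu_f(\Gamma)\subset\mathbb R^d$, where $M_0$ is compact and convex, and assume that $$\mu\mapsto\sqrt{\mathrm{Var}_{\tilde P_\mu}[f]}\ \text{ is concave in }\mu\in M_0\text{ for all } f\in\mathcal F .$$ Let the functional $T$ be linear in the mean parameter, i.e. $T(\gamma)=\langle h,\mu_f(\gamma)\rangle$ for some $h\in\mathbb R^d$, and define the constraint set $\Gamma_0=\gamma_r(M_0)$. Then $$c_0\,\omega_H(1/\sqrt n)\le\sqrt{R_n^*(\Gamma_0)}\le c_1\,\omega_H(1/\sqrt n),$$ and this rate is achieved by an estimator of the form $\hat T(X_1,\dots,X_n)=\frac1n\sum_{i=1}^n g(X_i)$ with $g\in\mathcal F$.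
   Context: A $d$-dimensional exponential family is given by a triplet $(\nu,\phi,\Gamma)$: a reference measure $\nu$ on $\mathcal X$, a measurable map $\phi:\mathcal X\to\mathbb R^d$, and $\Gamma\subset\mathbb R^d$, with $$P_\gamma(dx)=\exp\{\langle\gamma,\phi(x)\rangle-C(\gamma)\}\,\nu(dx),\qquad \gamma\in\Gamma,$$ where $C(\gamma)$ is the normalizing (log-partition) function. $\mathcal F=\{\langle a,\phi\rangle:a\in\mathbb R^d\}$ is the linear span of the coordinates of $\phi$. The mean parameter map is $\mu_f(\gamma)=\mathbb E_{X\sim P_\gamma}[\phi(X)]$. Under (1)–(2), $\mu_f$ is one-to-one on $\Gamma$ with open image $M=\mu_f(\Gamma)$; $\gamma_r:M\to\Gamma$ is its inverse, and $\tilde P_\mu=P_{\gamma_r(\mu)}$ is the member of the family with mean parameter $\mu$. The minimax quadratic risk based on $n$ observations is $$R_n^*(\Gamma_0)=\inf_{\hat T}\sup_{\gamma\in\Gamma_0}\mathbb E_{X_i\overset{\rm iid}\sim P_\gamma}\big[|\hat T(X_1,\dots,X_n)-T(\gamma)|^2\big].$$ The Hellinger modulus of continuity is $$\omega_H(t)=\sup\{T(\gamma)-T(\gamma'):\ \gamma,\gamma'\in\Gamma_0,\ H(P_\gamma,P_{\gamma'})\le t\},$$ with $H^2(P,Q)=\int(\sqrt{dP}-\sqrt{dQ})^2$.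
   Formalization: g ranges over F plus constants (⟨a,φ⟩+b) instead of F, since with g in F the last claim fails (Bernoulli, M_0={1/2}, h=1, n=1). The constants c_0, c_1 are stated per underlying set of X; one pair for all follows by a disjoint-union argument. *)

theory Defs
  imports "HOL-Probability.Probability"
begin

text \<open>
  The dimension \<open>d\<close> is quantified inside the theorem (after the absolute constants), so the points of
  \<open>R^d\<close> are the functions \<open>nat \<Rightarrow> real\<close> in \<^term>\<open>topspace (Euclidean_space d)\<close>, i.e. those vanishing at
  every index \<open>i \<ge> d\<close>, with the topology \<^term>\<open>Euclidean_space d\<close>. Since \<open>nat \<Rightarrow> real\<close> is not an instance of
  \<^class>\<open>real_vector\<close>, the library's \<^const>\<open>convex\<close> and \<^const>\<open>concave_on\<close> are restated coordinatewise.
\<close>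

abbreviation Rd :: "nat \<Rightarrow> (nat \<Rightarrow> real) set"
  where "Rd d \<equiv> topspace (Euclidean_space d)"

definition dot :: "nat \<Rightarrow> (nat \<Rightarrow> real) \<Rightarrow> (nat \<Rightarrow> real) \<Rightarrow> real"
  where "dot d x y = (\<Sum>i<d. x i * y i)"

definition seq_convex :: "(nat \<Rightarrow> real) set \<Rightarrow> bool"
  where "seq_convex S \<longleftrightarrow>
    (\<forall>x\<in>S. \<forall>y\<in>S. \<forall>u\<ge>0. \<forall>v\<ge>0. u + v = 1 \<longrightarrow> (\<lambda>i. u * x i + v * y i) \<in> S)"

definition seq_concave_on :: "(nat \<Rightarrow> real) set \<Rightarrow> ((nat \<Rightarrow> real) \<Rightarrow> real) \<Rightarrow> bool"
  where "seq_concave_on S f \<longleftrightarrow> seq_convex S \<and>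
    (\<forall>x\<in>S. \<forall>y\<in>S. \<forall>u\<ge>0. \<forall>v\<ge>0. u + v = 1 \<longrightarrow>
      u * f x + v * f y \<le> f (\<lambda>i. u * x i + v * y i))"


subsection \<open>Exponential families\<close>

text \<open>
  A statistic \<open>\<phi>\<close> with values in \<open>R^d\<close> is a function \<open>'a \<Rightarrow> nat \<Rightarrow> real\<close> of which only the coordinates
  \<open>i < d\<close> are ever used. The partition function is a nonnegative integral, hence possibly infinite;
  \<^term>\<open>ln\<close> of its real value is the log-partition function wherever the latter is finite.
\<close>

definition partition_fun :: "nat \<Rightarrow> 'a measure \<Rightarrow> ('a \<Rightarrow> nat \<Rightarrow> real) \<Rightarrow> (nat \<Rightarrow> real) \<Rightarrow> ennreal"
  where "partition_fun d \<nu> \<phi> \<gamma> = (\<integral>\<^sup>+x. ennreal (exp (dot d \<gamma> (\<phi> x))) \<partial>\<nu>)"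

definition log_partition :: "nat \<Rightarrow> 'a measure \<Rightarrow> ('a \<Rightarrow> nat \<Rightarrow> real) \<Rightarrow> (nat \<Rightarrow> real) \<Rightarrow> real"
  where "log_partition d \<nu> \<phi> \<gamma> = ln (enn2real (partition_fun d \<nu> \<phi> \<gamma>))"

definition ef_density :: "nat \<Rightarrow> 'a measure \<Rightarrow> ('a \<Rightarrow> nat \<Rightarrow> real) \<Rightarrow> (nat \<Rightarrow> real) \<Rightarrow> 'a \<Rightarrow> real"
  where "ef_density d \<nu> \<phi> \<gamma> x = exp (dot d \<gamma> (\<phi> x) - log_partition d \<nu> \<phi> \<gamma>)"

definition ef_dist :: "nat \<Rightarrow> 'a measure \<Rightarrow> ('a \<Rightarrow> nat \<Rightarrow> real) \<Rightarrow> (nat \<Rightarrow> real) \<Rightarrow> 'a measure"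
  where "ef_dist d \<nu> \<phi> \<gamma> = density \<nu> (\<lambda>x. ennreal (ef_density d \<nu> \<phi> \<gamma> x))"

definition lin_span :: "nat \<Rightarrow> ('a \<Rightarrow> nat \<Rightarrow> real) \<Rightarrow> ('a \<Rightarrow> real) set"
  where "lin_span d \<phi> = {(\<lambda>x. dot d a (\<phi> x)) | a. a \<in> Rd d}"

text \<open>
  The estimators range over the linear span together with the constants. Constants are invisible to
  variances, but the estimator cannot do without them: for Bernoulli observations with
  \<open>\<phi> x = x\<close> and the single admissible mean \<open>1/2\<close>, the modulus of \<open>T = 1/2\<close> vanishes, whereas no
  estimator \<open>a * X\<close> of one observation has zero risk.
\<close>

definition aff_span :: "nat \<Rightarrow> ('a \<Rightarrow> nat \<Rightarrow> real) \<Rightarrow> ('a \<Rightarrow> real) set"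
  where "aff_span d \<phi> = {(\<lambda>x. f x + b) | f b. f \<in> lin_span d \<phi>}"

definition mean_map :: "nat \<Rightarrow> 'a measure \<Rightarrow> ('a \<Rightarrow> nat \<Rightarrow> real) \<Rightarrow> (nat \<Rightarrow> real) \<Rightarrow> nat \<Rightarrow> real"
  where "mean_map d \<nu> \<phi> \<gamma> =
    (\<lambda>i. if i < d then (\<integral>x. \<phi> x i \<partial>ef_dist d \<nu> \<phi> \<gamma>) else 0)"

definition mean_inv ::
    "nat \<Rightarrow> 'a measure \<Rightarrow> ('a \<Rightarrow> nat \<Rightarrow> real) \<Rightarrow> (nat \<Rightarrow> real) set \<Rightarrow> (nat \<Rightarrow> real) \<Rightarrow> nat \<Rightarrow> real"
  where "mean_inv d \<nu> \<phi> \<Gamma> = inv_into \<Gamma> (mean_map d \<nu> \<phi>)"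


subsection \<open>Minimax quadratic risk and Hellinger modulus\<close>

text \<open>
  All suprema and infima are taken in \<^typ>\<open>ennreal\<close>, so that none of them needs a boundedness side condition.
\<close>

definition ennreal_sqrt :: "ennreal \<Rightarrow> ennreal"
  where "ennreal_sqrt x = (if x = \<infinity> then \<infinity> else ennreal (sqrt (enn2real x)))"

definition quad_risk ::
    "('t \<Rightarrow> 'a measure) \<Rightarrow> ('t \<Rightarrow> real) \<Rightarrow> 't set \<Rightarrow> nat \<Rightarrow> ((nat \<Rightarrow> 'a) \<Rightarrow> real) \<Rightarrow> ennreal"
  where "quad_risk P T \<Theta> n That =
    (SUP \<theta>\<in>\<Theta>. \<integral>\<^sup>+X. ennreal ((That X - T \<theta>)\<^sup>2) \<partial>(\<Pi>\<^sub>M i\<in>{..<n}. P \<theta>))"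

text \<open>
  The estimators are the real functions on the \<open>n\<close>-fold product of the measurable space
  underlying \<open>\<nu>\<close>; of \<open>\<nu>\<close> only the \<open>\<sigma>\<close>-algebra is used.
\<close>

definition minimax_risk ::
    "'a measure \<Rightarrow> ('t \<Rightarrow> 'a measure) \<Rightarrow> ('t \<Rightarrow> real) \<Rightarrow> 't set \<Rightarrow> nat \<Rightarrow> ennreal"
  where "minimax_risk \<nu> P T \<Theta> n =
    (INF That \<in> borel_measurable (\<Pi>\<^sub>M i\<in>{..<n}. \<nu>). quad_risk P T \<Theta> n That)"

text \<open>
  \<open>p\<close> and \<open>q\<close> are the densities of the two distributions with respect to the dominating measure \<open>\<nu>\<close>.
\<close>

definition hellinger :: "'a measure \<Rightarrow> ('a \<Rightarrow> real) \<Rightarrow> ('a \<Rightarrow> real) \<Rightarrow> real"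
  where "hellinger \<nu> p q = sqrt (\<integral>x. (sqrt (p x) - sqrt (q x))\<^sup>2 \<partial>\<nu>)"

text \<open>
  Truncating \<open>T \<theta> - T \<theta>'\<close> at \<open>0\<close> does not change the supremum for \<open>t \<ge> 0\<close> and nonempty \<open>\<Theta>\<close>, because
  the pairs \<open>(\<theta>, \<theta>)\<close> are admissible.
\<close>

definition hellinger_modulus ::
    "'a measure \<Rightarrow> ('t \<Rightarrow> 'a \<Rightarrow> real) \<Rightarrow> ('t \<Rightarrow> real) \<Rightarrow> 't set \<Rightarrow> real \<Rightarrow> ennreal"
  where "hellinger_modulus \<nu> p T \<Theta> t =
    (SUP (\<theta>, \<theta>') \<in> {(\<theta>, \<theta>'). \<theta> \<in> \<Theta> \<and> \<theta>' \<in> \<Theta> \<and> hellinger \<nu> (p \<theta>) (p \<theta>') \<le> t}.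
      ennreal (T \<theta> - T \<theta>'))"

end

theory Submission
  imports Defs
begin

text \<open>
  Write \<open>sd \<mu> a\<close> for the standard deviation of \<open>\<langle>a, \<phi>\<rangle>\<close> at mean parameter \<open>\<mu>\<close>, and \<open>t = 1 / sqrt n\<close>. The root
  risk of \<open>\<langle>a, \<phi>\<rangle> + b\<close>, averaged over the sample, is at most \<open>\<bar>\<langle>a - h, \<mu>\<rangle> + b\<bar> + t * sd \<mu> a\<close>. After
  optimising \<open>b\<close>, the best bound is half the infimum over \<open>a\<close> of the supremum over \<open>\<mu>, \<mu>' \<in> M0\<close> of
  \<open>\<langle>h - a, \<mu> - \<mu>'\<rangle> + t * (sd \<mu> a + sd \<mu>' a)\<close>. This is convex in \<open>a\<close> and, by the concavity hypothesis,
  concave in \<open>(\<mu>, \<mu>')\<close>, so by convex duality it equals the largest \<open>\<langle>h, \<mu> - \<mu>'\<rangle>\<close> among the pairs with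
  \<open>\<langle>a, \<mu> - \<mu>'\<rangle> \<le> t * (sd \<mu> a + sd \<mu>' a)\<close> for all \<open>a\<close>. For such a pair, concavity makes the variances
  comparable along the middle of the segment from \<open>\<mu>'\<close> to \<open>\<mu>\<close>. The Fisher information at \<open>\<mu>\<close> being
  dual to the covariance, this middle piece has Hellinger length at most \<open>t\<close>, while \<open>T\<close> still varies
  by \<open>\<langle>h, \<mu> - \<mu>'\<rangle> / 8\<close> along it; hence the upper bound with \<open>c1 = 4\<close>.

  The lower bound, with \<open>c0 = 1 / 4\<close>, is a two-point argument: the Hellinger affinity of the \<open>n\<close>-fold
  products is at least \<open>(1 - 1 / (2 * n)) ^ n \<ge> 1 / 2\<close>.
\<close>

section \<open>Bilinear pairing on R^d\<close>

lemma dot_add: "dot d a (\<lambda>i. x i + y i) = dot d a x + dot d a y"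
  "dot d (\<lambda>i. x i + y i) a = dot d x a + dot d y a"
  by (simp_all add: dot_def algebra_simps sum.distrib)

lemma dot_diff: "dot d a (\<lambda>i. x i - y i) = dot d a x - dot d a y"
  "dot d (\<lambda>i. x i - y i) a = dot d x a - dot d y a"
  by (simp_all add: dot_def algebra_simps sum_subtractf)

lemma dot_scale: "dot d a (\<lambda>i. u * x i) = u * dot d a x"
  "dot d (\<lambda>i. u * x i) a = u * dot d x a"
  by (simp_all add: dot_def algebra_simps sum_distrib_left)

lemma dot_zero [simp]: "dot d a (\<lambda>i. 0) = 0" "dot d (\<lambda>i. 0) a = 0"
  by (simp_all add: dot_def)

lemma dot_minus: "dot d a (\<lambda>i. - x i) = - dot d a x" "dot d (\<lambda>i. - x i) a = - dot d x a"
  by (simp_all add: dot_def sum_negf)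

lemma dot_unit: "k < d \<Longrightarrow> dot d a (\<lambda>i. if i = k then r else 0) = a k * r"
  "k < d \<Longrightarrow> dot d (\<lambda>i. if i = k then r else 0) a = r * a k"
  by (simp_all add: dot_def if_distrib if_distribR cong: if_cong)

lemma dot_commute: "dot d a b = dot d b a"
  by (simp add: dot_def mult.commute)

lemma abs_dot_le:
  assumes "\<And>i. i < d \<Longrightarrow> \<bar>a i\<bar> \<le> r"
  shows "\<bar>dot d a x\<bar> \<le> r * (\<Sum>i<d. \<bar>x i\<bar>)"
proof -
  have "\<bar>dot d a x\<bar> \<le> (\<Sum>i<d. \<bar>a i * x i\<bar>)"
    unfolding dot_def by (rule sum_abs)
  also have "\<dots> \<le> (\<Sum>i<d. r * \<bar>x i\<bar>)"
    using assms by (intro sum_mono) (auto simp: abs_mult intro: mult_right_mono)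
  finally show ?thesis by (simp add: sum_distrib_left)
qed

lemma in_Rd_iff: "x \<in> Rd d \<longleftrightarrow> (\<forall>i\<ge>d. x i = 0)"
  by (simp add: topspace_Euclidean_space)

section \<open>Convexity and elementary inequalities\<close>

text \<open>A chord of \<open>W\<close> from the right of the vertical axis to the left crosses the
  axis inside \<open>W\<close>, hence at height at most 0. So no slope \<open>w / x\<close> on the
  right exceeds one on the left, and the supremum of the right slopes gives a line through the
  origin above \<open>W\<close>.\<close>

lemma supergradient_coordinate_step:
  fixes W :: "(real \<times> real) set"
  assumes conv: "\<And>x w x' w' u v. (x, w) \<in> W \<Longrightarrow> (x', w') \<in> W \<Longrightarrow> 0 \<le> u \<Longrightarrow> 0 \<le> v \<Longrightarrow> u + v = 1
      \<Longrightarrow> (u * x + v * x', u * w + v * w') \<in> W"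
    and pos: "(x1, w1) \<in> W" "x1 > 0" and neg: "(x2, w2) \<in> W" "x2 < 0"
    and zero: "\<And>w. (0, w) \<in> W \<Longrightarrow> w \<le> 0"
  shows "\<exists>a. \<forall>(x, w) \<in> W. w \<le> a * x"
proof -
  have slopes: "w / x \<le> w' / x'" if "(x, w) \<in> W" "(x', w') \<in> W" "x > 0" "x' < 0" for x w x' w'
  proof -
    \<comment> \<open>These weights put the convex combination at abscissa 0.\<close>
    have "(- x' / (x - x') * x + x / (x - x') * x', - x' / (x - x') * w + x / (x - x') * w') \<in> W"
      using that by (intro conv) (simp_all add: divide_nonneg_pos divide_nonpos_pos flip: diff_divide_distrib)
    moreover have "- x' / (x - x') * x + x / (x - x') * x' = 0"
      by (simp add: field_simps)
    ultimately have "- x' / (x - x') * w + x / (x - x') * w' \<le> 0"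
      using zero by metis
    then have "(- x' * w + x * w') / (x - x') \<le> 0"
      by (simp add: add_divide_distrib diff_divide_distrib)
    then have "- x' * w + x * w' \<le> 0"
      using that by (simp add: divide_le_0_iff)
    then show ?thesis
      using that by (simp add: field_simps)
  qed
  \<comment> \<open>The point with positive abscissa makes \<open>A\<close> nonempty and the one
    with negative abscissa bounds it, so \<open>Sup A\<close> is meaningful.\<close>
  define A where "A = {w / x |x w. (x, w) \<in> W \<and> x > 0}"
  have ne: "A \<noteq> {}" using pos by (auto simp: A_def)
  have bdd: "bdd_above A"
    unfolding bdd_above_def A_def using slopes[OF _ neg(1) _ neg(2)] by blast
  have "w \<le> Sup A * x" if w: "(x, w) \<in> W" for x w
  proof (cases x "0 :: real" rule: linorder_cases)
    case less
    have "Sup A \<le> w / x"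
      using ne slopes[OF _ w _ less] by (intro cSup_least) (auto simp: A_def)
    then show ?thesis using less by (simp add: field_simps)
  next
    case equal
    then show ?thesis using zero w by simp
  next
    case greater
    have "w / x \<le> Sup A"
      using w greater bdd by (intro cSup_upper) (auto simp: A_def)
    then show ?thesis using greater by (simp add: field_simps)
  qed
  then show ?thesis by blast
qed

text \<open>Choosing \<open>a\<close> one coordinate at a time requires neither closedness nor compactness of \<open>S\<close>.\<close>

lemma supergradient_exists:
  fixes S :: "((nat \<Rightarrow> real) \<times> real) set"
  assumes conv: "\<And>x y x' y' u v. (x, y) \<in> S \<Longrightarrow> (x', y') \<in> S \<Longrightarrow> 0 \<le> u \<Longrightarrow> 0 \<le> v \<Longrightarrow> u + v = 1
      \<Longrightarrow> ((\<lambda>i. u * x i + v * x' i), u * y + v * y') \<in> S"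
    and pos: "\<And>k. k < d \<Longrightarrow> \<exists>r>0. \<exists>y. ((\<lambda>i. if i = k then r else 0), y) \<in> S"
    and neg: "\<And>k. k < d \<Longrightarrow> \<exists>r<0. \<exists>y. ((\<lambda>i. if i = k then r else 0), y) \<in> S"
    and zero: "\<And>x y. (x, y) \<in> S \<Longrightarrow> (\<forall>i<d. x i = 0) \<Longrightarrow> y \<le> D"
  shows "\<exists>a\<in>Rd d. \<forall>(x, y)\<in>S. y \<le> D + dot d a x"
proof -
  \<comment> \<open>After \<open>k\<close> coordinates of \<open>a\<close> are chosen, the bound
    holds on the slice of \<open>S\<close> where coordinates \<open>k\<close> to
    \<open>d - 1\<close> vanish; at \<open>k = d\<close> the slice is all of
    \<open>S\<close>.\<close>
  have "\<exists>a. (\<forall>i\<ge>k. a i = 0) \<and>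
      (\<forall>x y. (x, y) \<in> S \<longrightarrow> (\<forall>i. k \<le> i \<and> i < d \<longrightarrow> x i = 0) \<longrightarrow> y \<le> D + dot k a x)"
    if "k \<le> d" for k
    using that
  proof (induction k)
    case 0
    show ?case
      by (rule exI[of _ "\<lambda>_. 0"]) (use zero in auto)
  next
    case (Suc k)
    then obtain a where a0: "\<And>i. i \<ge> k \<Longrightarrow> a i = 0"
      and a: "\<And>x y. (x, y) \<in> S \<Longrightarrow> (\<forall>i. k \<le> i \<and> i < d \<longrightarrow> x i = 0) \<Longrightarrow> y \<le> D + dot k a x"
      by auto
    \<comment> \<open>Coordinate \<open>k\<close> is released: \<open>W\<close> records it together
      with the excess of \<open>y\<close> over the bound found so far. Points of \<open>W\<close> on
      the vertical axis come from the previous slice, so their excess is at most 0.\<close>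
    define W where
      "W = {(x k, y - D - dot k a x) |x y. (x, y) \<in> S \<and> (\<forall>i. Suc k \<le> i \<and> i < d \<longrightarrow> x i = 0)}"
    have "\<exists>b. \<forall>(x, w) \<in> W. w \<le> b * x"
    proof -
      obtain r1 y1 where 1: "r1 > 0" "((\<lambda>i. if i = k then r1 else 0), y1) \<in> S"
        using pos[of k] Suc.prems by auto
      obtain r2 y2 where 2: "r2 < 0" "((\<lambda>i. if i = k then r2 else 0), y2) \<in> S"
        using neg[of k] Suc.prems by auto
      show ?thesis
      proof (rule supergradient_coordinate_step)
        show "(r1, y1 - D - dot k a (\<lambda>i. if i = k then r1 else 0)) \<in> W"
          using 1 unfolding W_def by (intro CollectI exI conjI) (rule refl | auto)+
        show "(r2, y2 - D - dot k a (\<lambda>i. if i = k then r2 else 0)) \<in> W"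
          using 2 unfolding W_def by (intro CollectI exI conjI) (rule refl | auto)+
        show "w \<le> 0" if w: "(0, w) \<in> W" for w
        proof -
          obtain x y where "x k = 0" "w = y - D - dot k a x" "(x, y) \<in> S"
            "\<And>i. Suc k \<le> i \<Longrightarrow> i < d \<Longrightarrow> x i = 0"
            using w unfolding W_def by auto
          then have "\<forall>i. k \<le> i \<and> i < d \<longrightarrow> x i = 0"
            by (metis Suc_leI nless_le)
          then show ?thesis using a[OF \<open>(x, y) \<in> S\<close>] \<open>w = _\<close> by simp
        qed
        show "(u * x + v * x', u * w + v * w') \<in> W"
          if "(x, w) \<in> W" "(x', w') \<in> W" and uv: "0 \<le> u" "0 \<le> v" "u + v = 1" for x w x' w' u v
        proof -
          obtain p q where p: "x = p k" "w = q - D - dot k a p" "(p, q) \<in> S"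
            "\<forall>i. Suc k \<le> i \<and> i < d \<longrightarrow> p i = 0"
            using \<open>(x, w) \<in> W\<close> unfolding W_def by auto
          obtain p' q' where p': "x' = p' k" "w' = q' - D - dot k a p'" "(p', q') \<in> S"
            "\<forall>i. Suc k \<le> i \<and> i < d \<longrightarrow> p' i = 0"
            using \<open>(x', w') \<in> W\<close> unfolding W_def by auto
          have v: "v = 1 - u" using uv by simp
          have e: "u * w + v * w' = (u * q + v * q') - D - dot k a (\<lambda>i. u * p i + v * p' i)"
            unfolding p p' dot_add dot_scale v by (simp add: algebra_simps)
          show ?thesis
            unfolding W_def using conv[OF p(3) p'(3) uv] p(4) p'(4)
            by (intro CollectI exI[of _ "\<lambda>i. u * p i + v * p' i"] exI[of _ "u * q + v * q'"] conjI)
              (auto simp: e p(1) p'(1))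
        qed
      qed (use 1 2 in auto)
    qed
    then obtain b where b: "\<And>x w. (x, w) \<in> W \<Longrightarrow> w \<le> b * x" by auto
    have "y \<le> D + dot (Suc k) (a(k := b)) x"
      if "(x, y) \<in> S" "\<forall>i. Suc k \<le> i \<and> i < d \<longrightarrow> x i = 0" for x y
    proof -
      have "(x k, y - D - dot k a x) \<in> W" unfolding W_def using that by auto
      from b[OF this] have "y \<le> D + dot k a x + b * x k" by simp
      also have "dot k a x = dot k (a(k := b)) x" by (auto simp: dot_def intro: sum.cong)
      finally show ?thesis by (simp add: dot_def)
    qed
    moreover have "\<forall>i\<ge>Suc k. (a(k := b)) i = 0"
      using a0 by simp
    ultimately show ?case by blast
  qed
  from this[of d] obtain a where "\<forall>i\<ge>d. a i = 0" "\<And>x y. (x, y) \<in> S \<Longrightarrow> y \<le> D + dot d a x"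
    by auto
  then show ?thesis unfolding in_Rd_iff[symmetric] by blast
qed

text \<open>By Tychonoff the product of \<open>{-1..1}\<close> for \<open>i < d\<close> and
  \<open>{0}\<close> beyond is compact in the function space; the sphere is its intersection with a
  closed set.\<close>

lemma compact_unit_sphere_Rd: "compact {a \<in> Rd d. (\<Sum>i<d. (a i)\<^sup>2) = 1}"
proof -
  have "compactin (powertop_real UNIV) (PiE UNIV (\<lambda>i. if i < d then {-1..1} else {0}))"
    by (subst compactin_PiE) auto
  then have c: "compact (PiE UNIV (\<lambda>i. if i < d then {-1..1} else {0::real}))"
    unfolding euclidean_product_topology by simp
  have "continuous_on UNIV (\<lambda>a::nat \<Rightarrow> real. \<Sum>i<d. (a i)\<^sup>2)"
    by (intro continuous_intros) auto
  then have "closed ((\<lambda>a::nat \<Rightarrow> real. \<Sum>i<d. (a i)\<^sup>2) -` {1})"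
    by (intro closed_vimage) auto
  with c have "compact (PiE UNIV (\<lambda>i. if i < d then {-1..1} else {0::real})
      \<inter> (\<lambda>a. \<Sum>i<d. (a i)\<^sup>2) -` {1})"
    by (rule compact_Int_closed)
  also have "\<dots> = {a \<in> Rd d. (\<Sum>i<d. (a i)\<^sup>2) = 1}"
  proof -
    have "\<bar>a k\<bar> \<le> 1" if "(\<Sum>i<d. (a i)\<^sup>2) = 1" "k < d" for a :: "nat \<Rightarrow> real" and k
    proof -
      have "(a k)\<^sup>2 \<le> (\<Sum>i<d. (a i)\<^sup>2)" using that(2) by (intro member_le_sum) auto
      then show ?thesis using that(1) by (simp add: abs_square_le_1)
    qed
    then have box: "a k \<le> 1" "- 1 \<le> a k" if "(\<Sum>i<d. (a i)\<^sup>2) = 1" "k < d" for a :: "nat \<Rightarrow> real" and k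
      using that by (simp_all add: abs_le_iff minus_le_iff)
    show ?thesis
      by (auto simp: PiE_UNIV_domain in_Rd_iff Pi_iff intro: box split: if_splits)
  qed
  finally show ?thesis .
qed

text \<open>The constant is the minimum of the form over the compact unit sphere, carried to all
  vectors by homogeneity. For \<open>d = 0\<close> the sphere is empty and both sides are 0.\<close>

lemma positive_form_lower_bound:
  fixes q :: "nat \<Rightarrow> nat \<Rightarrow> real"
  assumes "\<And>a. a \<in> Rd d \<Longrightarrow> a \<noteq> (\<lambda>_. 0) \<Longrightarrow> 0 < (\<Sum>i<d. \<Sum>j<d. a i * a j * q i j)"
  shows "\<exists>c>0. \<forall>a\<in>Rd d. c * (\<Sum>i<d. (a i)\<^sup>2) \<le> (\<Sum>i<d. \<Sum>j<d. a i * a j * q i j)"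
proof (cases "d = 0")
  case True
  then show ?thesis by (intro exI[of _ 1]) auto
next
  case False
  define Q where "Q a = (\<Sum>i<d. \<Sum>j<d. a i * a j * q i j)" for a
  define K where "K = {a \<in> Rd d. (\<Sum>i<d. (a i)\<^sup>2) = 1}"
  have "(\<lambda>i. if i = 0 then 1 else 0) \<in> K"
    using False by (auto simp: K_def in_Rd_iff if_distrib[of "\<lambda>x. x\<^sup>2"] cong: if_cong)
  then have "K \<noteq> {}" by auto
  moreover have "continuous_on K Q"
    unfolding Q_def by (intro continuous_intros continuous_on_subset[OF continuous_on_product_coordinates]) auto
  ultimately obtain b where b: "b \<in> K" "\<And>a. a \<in> K \<Longrightarrow> Q b \<le> Q a"
    using continuous_attains_inf[of K Q] compact_unit_sphere_Rd[of d] unfolding K_def by blast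
  have "Q b > 0"
    unfolding Q_def using b(1) by (intro assms) (auto simp: K_def)
  moreover have "Q b * (\<Sum>i<d. (a i)\<^sup>2) \<le> Q a" if a: "a \<in> Rd d" for a
  proof (cases "(\<Sum>i<d. (a i)\<^sup>2) = 0")
    case True
    then have "\<forall>i<d. a i = 0"
      by (subst (asm) sum_nonneg_eq_0_iff) auto
    then have "Q a = 0" by (simp add: Q_def)
    then show ?thesis by (simp add: True)
  next
    case False
    define s where "s = (\<Sum>i<d. (a i)\<^sup>2)"
    have s: "s > 0" using False by (simp add: s_def sum_nonneg order_less_le)
    define r where "r = 1 / sqrt s"
    have r: "r\<^sup>2 = 1 / s" using s by (simp add: r_def power_divide)
    have "(\<Sum>i<d. (r * a i)\<^sup>2) = r\<^sup>2 * s"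
      by (simp add: s_def power_mult_distrib sum_distrib_left)
    then have "(\<lambda>i. r * a i) \<in> K" using a s by (auto simp: K_def in_Rd_iff r)
    from b(2)[OF this] have "Q b \<le> r\<^sup>2 * Q a"
      by (simp add: Q_def sum_distrib_left power2_eq_square algebra_simps)
    then show ?thesis using s by (simp add: r field_simps s_def)
  qed
  ultimately show ?thesis by (auto simp: Q_def)
qed

lemma openin_Euclidean_space_contains_box:
  assumes "openin (Euclidean_space d) U" "x \<in> U"
  shows "\<exists>r>0. \<forall>y\<in>Rd d. (\<forall>i<d. \<bar>y i\<bar> \<le> r) \<longrightarrow> (\<lambda>i. x i + y i) \<in> U"
proof -
  obtain V where V: "openin (powertop_real UNIV) V" "U = V \<inter> {x. \<forall>i\<ge>d. x i = 0}"
    using assms(1) by (auto simp: Euclidean_space_def openin_subtopology)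
  have "x \<in> V" using assms V by auto
  from product_topology_open_contains_basis[OF V(1) this]
  obtain X where X: "x \<in> PiE UNIV X" "\<And>i. openin euclideanreal (X i)" "PiE UNIV X \<subseteq> V" "finite {i. X i \<noteq> UNIV}"
    by auto
  have "\<exists>r>0. \<forall>z. \<bar>z\<bar> \<le> r \<longrightarrow> x i + z \<in> X i" for i
  proof -
    have "open (X i)" "x i \<in> X i" using X by (auto simp: PiE_UNIV_domain)
    then obtain e where e: "e > 0" "cball (x i) e \<subseteq> X i" by (meson open_contains_cball)
    have "x i + z \<in> cball (x i) e" if "\<bar>z\<bar> \<le> e" for z using that by (simp add: dist_real_def)
    with e show ?thesis by blast
  qed
  then obtain r where r: "\<And>i. r i > 0" "\<And>i z. \<bar>z\<bar> \<le> r i \<Longrightarrow> x i + z \<in> X i" by metis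
  \<comment> \<open>The inserted 1 keeps the minimum defined when \<open>d = 0\<close>. Coordinates
    from \<open>d\<close> on need no radius because \<open>y\<close> vanishes there.\<close>
  define m where "m = Min (insert 1 (r ` {..<d}))"
  have "m > 0" using r(1) by (auto simp: m_def)
  have m: "m \<le> r i" if "i < d" for i using that by (auto simp: m_def intro: Min_le)
  have "(\<lambda>i. x i + y i) \<in> U" if y: "y \<in> Rd d" "\<forall>i<d. \<bar>y i\<bar> \<le> m" for y
  proof -
    have "x i + y i \<in> X i" for i
    proof (cases "i < d")
      case True
      then show ?thesis using y(2) m[OF True] by (intro r(2)) force
    next
      case False
      then have "y i = 0" using y(1) by (auto simp: in_Rd_iff)
      then show ?thesis using r(2)[of 0 i] r(1)[of i] by simp
    qed
    then have "(\<lambda>i. x i + y i) \<in> V" using X(3) by auto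
    moreover have "(\<lambda>i. x i + y i) i = 0" if "i \<ge> d" for i
      using that y(1) assms(2) V(2) by (auto simp: in_Rd_iff)
    ultimately show ?thesis using V(2) by auto
  qed
  then show ?thesis using \<open>m > 0\<close> by blast
qed

text \<open>Bounds on two intervals sharing an endpoint add up, so the bisection principle spreads a
  bound around each point to the whole interval. The radius may depend on the point, which is all
  that the local estimate in \<open>hellinger_close_pair\<close> provides.\<close>

lemma pointwise_lipschitz_imp_lipschitz:
  fixes f :: "real \<Rightarrow> real"
  assumes "a \<le> b"
    and loc: "\<And>x. a \<le> x \<Longrightarrow> x \<le> b \<Longrightarrow> \<exists>r>0. \<forall>y. a \<le> y \<and> y \<le> b \<and> \<bar>y - x\<bar> < r \<longrightarrow> \<bar>f y - f x\<bar> \<le> L * \<bar>y - x\<bar>"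
  shows "\<bar>f b - f a\<bar> \<le> L * (b - a)"
proof -
  have "a \<le> a \<and> b \<le> b \<longrightarrow> \<bar>f b - f a\<bar> \<le> L * (b - a)"
    using \<open>a \<le> b\<close>
  proof (rule Bolzano[where P = "\<lambda>u v. a \<le> u \<and> v \<le> b \<longrightarrow> \<bar>f v - f u\<bar> \<le> L * (v - u)"])
    fix x assume "a \<le> x" "x \<le> b"
    with loc obtain r where r: "r > 0"
      "\<And>y. a \<le> y \<Longrightarrow> y \<le> b \<Longrightarrow> \<bar>y - x\<bar> < r \<Longrightarrow> \<bar>f y - f x\<bar> \<le> L * \<bar>y - x\<bar>"
      by blast
    show "\<exists>e>0. \<forall>u v. u \<le> x \<and> x \<le> v \<and> v - u < e \<longrightarrow> a \<le> u \<and> v \<le> b \<longrightarrow> \<bar>f v - f u\<bar> \<le> L * (v - u)"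
    proof (intro exI[of _ r] conjI allI impI)
      fix u v assume *: "u \<le> x \<and> x \<le> v \<and> v - u < r" "a \<le> u \<and> v \<le> b"
      have "\<bar>f u - f x\<bar> \<le> L * (x - u)" "\<bar>f v - f x\<bar> \<le> L * (v - x)"
        using r(2)[of u] r(2)[of v] * by auto
      then show "\<bar>f v - f u\<bar> \<le> L * (v - u)" by (simp add: algebra_simps)
    qed (use r in auto)
  qed (auto simp: algebra_simps)
  then show ?thesis by simp
qed

text \<open>The shift is the supremum of \<open>f\<close> over \<open>A\<close> minus
  \<open>D / 2\<close>, which balances the two bounds. It later becomes the constant term of the
  estimator, with \<open>f\<close> and \<open>g\<close> carrying the two signs of the bias.\<close>

lemma separate_additive_bound:
  fixes f g :: "'b \<Rightarrow> real"
  assumes "\<And>x y. x \<in> A \<Longrightarrow> y \<in> A \<Longrightarrow> f x + g y \<le> D"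
  shows "\<exists>b. \<forall>x\<in>A. f x \<le> D / 2 + b \<and> g x \<le> D / 2 - b"
proof (cases "A = {}")
  case False
  then obtain z where z: "z \<in> A" by auto
  have bdd: "bdd_above (f ` A)"
    using assms[OF _ z] by (auto simp: bdd_above_def intro!: exI[of _ "D - g z"] simp: le_diff_eq)
  have "f x \<le> Sup (f ` A)" if "x \<in> A" for x using that bdd by (intro cSup_upper) auto
  moreover have "Sup (f ` A) \<le> D - g x" if "x \<in> A" for x
    using False assms[OF _ that] by (intro cSup_least) (auto simp: le_diff_eq)
  ultimately show ?thesis
    by (intro exI[of _ "Sup (f ` A) - D / 2"]) force
qed auto

section \<open>Scalar inequalities for the exponential function\<close>

lemma sqrt_exp: "sqrt (exp u) = exp (u / 2)" for u :: real
  by (rule real_sqrt_unique) (simp_all add: power2_eq_square flip: exp_add)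

lemma abs_mult_le_power2_sum: "\<bar>u * v\<bar> \<le> u\<^sup>2 + v\<^sup>2" for u v :: real
  using sum_squares_bound[of "\<bar>u\<bar>" "\<bar>v\<bar>"] abs_ge_zero[of "u * v"] unfolding abs_mult power2_abs by linarith

text \<open>With \<open>y\<close> and \<open>z\<close> the log-densities of two members of the
  family, this is the integrand form of the bound of squared Hellinger distance by Jeffreys
  divergence. The tangent of the exponential at the larger argument bounds the difference on the
  left.\<close>

lemma exp_half_diff_square_le:
  fixes y z :: real
  shows "(exp (y / 2) - exp (z / 2))\<^sup>2 \<le> (exp y - exp z) * (y - z)"
proof -
  have *: "(exp (y / 2) - exp (z / 2))\<^sup>2 \<le> (exp y - exp z) * (y - z)" if "z \<le> y" for y z :: real
  proof -
    have "exp (z / 2) - exp (y / 2) \<ge> exp (y / 2) * ((z - y) / 2)"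
    proof -
      have "exp (y / 2) * (1 + (z - y) / 2) \<le> exp (y / 2) * exp ((z - y) / 2)"
        by (intro mult_left_mono exp_ge_add_one_self) auto
      also have "\<dots> = exp (z / 2)" by (simp flip: exp_add add: field_simps)
      finally show ?thesis by (simp add: algebra_simps)
    qed
    then have "exp (y / 2) - exp (z / 2) \<le> exp (y / 2) * ((y - z) / 2)"
      by (simp add: field_simps)
    \<comment> \<open>The factor is deliberately enlarged to a sum, so that multiplying by the
      difference of the exponentials produces a difference of squares.\<close>
    also have "\<dots> \<le> (exp (y / 2) + exp (z / 2)) * (y - z)"
      using that by (intro mult_mono) auto
    finally have "(exp (y / 2) - exp (z / 2)) * (exp (y / 2) - exp (z / 2))
        \<le> (exp (y / 2) - exp (z / 2)) * ((exp (y / 2) + exp (z / 2)) * (y - z))"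
      using that by (intro mult_left_mono) auto
    also have "\<dots> = ((exp (y / 2))\<^sup>2 - (exp (z / 2))\<^sup>2) * (y - z)"
      by (simp add: power2_eq_square algebra_simps)
    also have "\<dots> = (exp y - exp z) * (y - z)"
      by (simp add: power2_eq_square flip: exp_add)
    finally show ?thesis by (simp add: power2_eq_square)
  qed
  show ?thesis
  proof (cases "z \<le> y")
    case False
    with *[of y z] show ?thesis by (simp add: power2_commute minus_mult_minus algebra_simps)
  qed (rule *)
qed

text \<open>A polynomial minorant that integrates to second and fourth moments. For
  \<open>z \<ge> 0\<close> it follows from \<open>z \<le> exp z - 1\<close>; for
  \<open>z < 0\<close> from an upper Taylor bound for \<open>exp z\<close>.\<close>

lemma mult_exp_minus_one_ge:
  fixes z :: real
  shows "3 / 4 * z\<^sup>2 - z^4 / 4 \<le> z * (exp z - 1)"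
proof (cases "z \<ge> 0")
  case True
  have "z * z \<le> z * (exp z - 1)"
    using True exp_ge_add_one_self[of z] by (intro mult_left_mono) linarith+
  moreover have "0 \<le> z^4" "0 \<le> z * z" by auto
  ultimately show ?thesis unfolding power2_eq_square by linarith
next
  case False
  have "exp z \<le> 1 + z + z\<^sup>2 / 2"
  proof -
    \<comment> \<open>The Taylor bound is obtained through the reciprocal \<open>exp (- z)\<close>,
      using that \<open>1 + z + z^2 / 2\<close> times \<open>1 - z + z^2 / 2\<close> equals
      \<open>1 + z^4 / 4\<close>.\<close>
    have "exp z * (1 - z + z\<^sup>2 / 2) \<le> 1"
    proof -
      have "1 + (- z) + (- z)\<^sup>2 / 2 \<le> exp (- z)"
        using False exp_lower_Taylor_quadratic[of "- z"] by simp
      then have "exp z * (1 - z + z\<^sup>2 / 2) \<le> exp z * exp (- z)"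
        by (intro mult_left_mono) auto
      then show ?thesis by (simp flip: exp_add)
    qed
    moreover have "1 \<le> (1 + z + z\<^sup>2 / 2) * (1 - z + z\<^sup>2 / 2)"
      using zero_le_power2[of "z\<^sup>2"] by (simp add: power2_eq_square algebra_simps power4_eq_xxxx)
    moreover have "1 - z + z\<^sup>2 / 2 > 0" using False by (simp add: add_pos_nonneg)
    ultimately have "exp z * (1 - z + z\<^sup>2 / 2) \<le> (1 + z + z\<^sup>2 / 2) * (1 - z + z\<^sup>2 / 2)" by linarith
    with \<open>1 - z + z\<^sup>2 / 2 > 0\<close> show ?thesis using mult_le_cancel_right_pos by blast
  qed
  then have "z * (z + z\<^sup>2 / 2) \<le> z * (exp z - 1)"
    using False by (intro mult_left_mono_neg) auto
  moreover have "z * (z + z\<^sup>2 / 2) - (3 / 4 * z\<^sup>2 - z^4 / 4) = (z * (1 + z) / 2)\<^sup>2"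
    by (simp add: power2_eq_square algebra_simps power4_eq_xxxx)
  ultimately show ?thesis using zero_le_power2[of "z * (1 + z) / 2"] by linarith
qed

section \<open>Product measures and two-point bounds\<close>

lemma integral_Cauchy_Schwarz:
  fixes f g :: "'b \<Rightarrow> real"
  assumes f: "integrable M (\<lambda>x. (f x)\<^sup>2)" and g: "integrable M (\<lambda>x. (g x)\<^sup>2)"
    and fg: "integrable M (\<lambda>x. f x * g x)"
  shows "(\<integral>x. f x * g x \<partial>M) \<le> sqrt (\<integral>x. (f x)\<^sup>2 \<partial>M) * sqrt (\<integral>x. (g x)\<^sup>2 \<partial>M)"
proof -
  define A B D where "A = (\<integral>x. (f x)\<^sup>2 \<partial>M)" "B = (\<integral>x. (g x)\<^sup>2 \<partial>M)" "D = (\<integral>x. f x * g x \<partial>M)"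
  note ABD = A_B_D_def
  have nonneg: "A \<ge> 0" "B \<ge> 0" by (auto simp: ABD)
  \<comment> \<open>A quadratic in \<open>s\<close> that is nowhere negative has nonpositive
    discriminant, which is the claim.\<close>
  have q: "0 \<le> s\<^sup>2 * A - 2 * s * D + B" for s
  proof -
    have "0 \<le> (\<integral>x. (s * f x - g x)\<^sup>2 \<partial>M)" by simp
    also have "\<dots> = (\<integral>x. s\<^sup>2 * (f x)\<^sup>2 - 2 * s * (f x * g x) + (g x)\<^sup>2 \<partial>M)"
      by (intro Bochner_Integration.integral_cong) (auto simp: power2_eq_square algebra_simps)
    also have "\<dots> = s\<^sup>2 * A - 2 * s * D + B"
      using f g fg by (simp add: ABD)
    finally show ?thesis .
  qed
  have "D\<^sup>2 \<le> A * B"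
  proof (cases "A = 0")
    case True
    have "D = 0"
    proof (rule ccontr)
      assume "D \<noteq> 0"
      \<comment> \<open>At this \<open>s\<close> the expression, linear since \<open>A = 0\<close>,
        takes the value -1.\<close>
      then show False using q[of "(B + 1) / (2 * D)"] nonneg True by (simp add: field_simps)
    qed
    then show ?thesis using True by simp
  next
    case False
    then have "A > 0" using nonneg by simp
    then show ?thesis using q[of "D / A"] by (simp add: power2_eq_square field_simps)
  qed
  then have "\<bar>D\<bar> \<le> sqrt (A * B)" using real_sqrt_le_mono by fastforce
  then show ?thesis by (simp add: ABD real_sqrt_mult)
qed

text \<open>One term of the exponential series is at most the whole sum.\<close>

lemma power_le_fact_mult_exp:
  fixes x :: real
  assumes "0 \<le> x"
  shows "x ^ k \<le> fact k * exp x"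
proof -
  have "(\<Sum>n\<in>{k}. x ^ n /\<^sub>R fact n) \<le> (\<Sum>n. x ^ n /\<^sub>R fact n)"
    using assms summable_exp_generic[of x] by (intro sum_le_suminf) auto
  then show ?thesis by (simp add: exp_def field_simps)
qed

text \<open>Both sides agree on measurable rectangles, where the integral of the product of the
  \<open>L (X i)\<close> factorises, and a product measure is determined by these values.\<close>

lemma PiM_density:
  fixes L :: "'b \<Rightarrow> ennreal"
  assumes "prob_space M" "prob_space (density M L)" and [measurable]: "L \<in> borel_measurable M" and "finite I"
  shows "(\<Pi>\<^sub>M i\<in>I. density M L) = density (\<Pi>\<^sub>M i\<in>I. M) (\<lambda>X. \<Prod>i\<in>I. L (X i))"
proof (rule sym)
  interpret M: prob_space M by fact
  interpret Q: prob_space "density M L" by fact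
  interpret M: product_prob_space "\<lambda>_. M" I ..
  interpret Q: product_prob_space "\<lambda>_. density M L" I ..
  show "density (\<Pi>\<^sub>M i\<in>I. M) (\<lambda>X. \<Prod>i\<in>I. L (X i)) = (\<Pi>\<^sub>M i\<in>I. density M L)"
  proof (rule Q.PiM_eqI)
    show "sets (density (\<Pi>\<^sub>M i\<in>I. M) (\<lambda>X. \<Prod>i\<in>I. L (X i))) = sets (\<Pi>\<^sub>M i\<in>I. density M L)"
      by (simp cong: sets_PiM_cong)
    fix A assume A: "\<And>i. i \<in> I \<Longrightarrow> A i \<in> sets (density M L)"
    then have A': "\<And>i. i \<in> I \<Longrightarrow> A i \<in> sets M" by simp
    have "emeasure (density (\<Pi>\<^sub>M i\<in>I. M) (\<lambda>X. \<Prod>i\<in>I. L (X i))) (Pi\<^sub>E I A)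
        = (\<integral>\<^sup>+X. (\<Prod>i\<in>I. L (X i)) * indicator (Pi\<^sub>E I A) X \<partial>(\<Pi>\<^sub>M i\<in>I. M))"
      using A' \<open>finite I\<close> by (intro emeasure_density) (auto intro!: sets_PiM_I_finite)
    also have "\<dots> = (\<integral>\<^sup>+X. (\<Prod>i\<in>I. L (X i) * indicator (A i) (X i)) \<partial>(\<Pi>\<^sub>M i\<in>I. M))"
      using \<open>finite I\<close>
      by (intro nn_integral_cong) (auto simp: prod.distrib indicator_def space_PiM PiE_iff)
    also have "\<dots> = (\<Prod>i\<in>I. \<integral>\<^sup>+x. L x * indicator (A i) x \<partial>M)"
      using A' \<open>finite I\<close> by (intro M.product_nn_integral_prod) auto
    also have "\<dots> = (\<Prod>i\<in>I. emeasure (density M L) (A i))"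
      using A' by (intro prod.cong) (auto simp: emeasure_density)
    finally show "emeasure (density (\<Pi>\<^sub>M i\<in>I. M) (\<lambda>X. \<Prod>i\<in>I. L (X i))) (Pi\<^sub>E I A)
        = (\<Prod>i\<in>I. emeasure (density M L) (A i))" .
  qed fact
qed

text \<open>Le Cam's argument with the Hellinger affinity. The triangle inequality \<open>\<bar>s -
  s'\<bar> \<le> \<bar>f X - s\<bar> + \<bar>f X - s'\<bar>\<close> is integrated against the square
  root \<open>g\<close> of the likelihood ratio of the samples, and Cauchy-Schwarz bounds each term
  by \<open>sqrt R\<close>.\<close>

lemma two_point_lower_bound:
  fixes L :: "'b \<Rightarrow> real" and f :: "(nat \<Rightarrow> 'b) \<Rightarrow> real"
  assumes M: "prob_space M" and Q: "prob_space (density M (\<lambda>x. ennreal (L x)))"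
    and L: "L \<in> borel_measurable M" "\<And>x. 0 \<le> L x" "integrable M (\<lambda>x. sqrt (L x))"
    and f: "f \<in> borel_measurable (\<Pi>\<^sub>M i\<in>{..<n}. M)"
    and R: "0 \<le> R" "(\<integral>\<^sup>+X. ennreal ((f X - s)\<^sup>2) \<partial>(\<Pi>\<^sub>M i\<in>{..<n}. M)) \<le> ennreal R"
      "(\<integral>\<^sup>+X. ennreal ((f X - s')\<^sup>2) \<partial>(\<Pi>\<^sub>M i\<in>{..<n}. density M (\<lambda>x. ennreal (L x)))) \<le> ennreal R"
  shows "\<bar>s - s'\<bar> * (\<integral>x. sqrt (L x) \<partial>M) ^ n \<le> 2 * sqrt R"
proof -
  note [measurable] = L(1) f
  interpret prob_space M by fact
  interpret product_sigma_finite "\<lambda>_::nat. M" ..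
  let ?N = "\<Pi>\<^sub>M i\<in>{..<n}. M"
  interpret N: prob_space ?N by (rule prob_space_PiM) (rule M)
  \<comment> \<open>Under the first law \<open>g\<close> integrates to the \<open>n\<close>-th power
    of the affinity, and its square integrates to 1.\<close>
  define g where "g X = (\<Prod>i<n. sqrt (L (X i)))" for X :: "nat \<Rightarrow> 'b"
  have g0: "0 \<le> g X" for X using L(2) by (auto simp: g_def intro: prod_nonneg)
  have g2: "(g X)\<^sup>2 = (\<Prod>i<n. L (X i))" for X
    using L(2) by (simp add: g_def prod_power_distrib)
  have int_g: "integrable ?N g" and val_g: "integral\<^sup>L ?N g = (\<integral>x. sqrt (L x) \<partial>M) ^ n"
    unfolding g_def[abs_def] using L(3) product_integrable_prod[of "{..<n}" "\<lambda>_ x. sqrt (L x)"]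
      product_integral_prod[of "{..<n}" "\<lambda>_ x. sqrt (L x)"] by auto
  note [measurable] = borel_measurable_integrable[OF int_g]
  have Q_eq: "(\<integral>\<^sup>+X. ennreal (h X) \<partial>(\<Pi>\<^sub>M i\<in>{..<n}. density M (\<lambda>x. ennreal (L x)))) = (\<integral>\<^sup>+X. ennreal ((g X)\<^sup>2 * h X) \<partial>?N)"
    if [measurable]: "h \<in> borel_measurable ?N" and "\<And>X. 0 \<le> h X" for h
  proof -
    have "(\<Prod>i<n. ennreal (L (X i))) = ennreal ((g X)\<^sup>2)" for X
      using L(2) by (simp add: g2 prod_ennreal)
    then show ?thesis
      using that(2) by (subst PiM_density[OF M Q]) (simp_all add: nn_integral_density ennreal_mult')
  qed
  have int_g2: "integrable ?N (\<lambda>X. (g X)\<^sup>2)" and val_g2: "(\<integral>X. (g X)\<^sup>2 \<partial>?N) = 1"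
  proof -
    interpret QN: prob_space "\<Pi>\<^sub>M i\<in>{..<n}. density M (\<lambda>x. ennreal (L x))"
      by (rule prob_space_PiM) (rule Q)
    have "(\<integral>\<^sup>+X. ennreal ((g X)\<^sup>2) \<partial>?N) = ennreal 1"
      using Q_eq[of "\<lambda>_. 1"] by (simp add: QN.emeasure_space_1)
    then have "has_bochner_integral ?N (\<lambda>X. (g X)\<^sup>2) 1"
      by (intro has_bochner_integral_nn_integral) auto
    then show "integrable ?N (\<lambda>X. (g X)\<^sup>2)" "(\<integral>X. (g X)\<^sup>2 \<partial>?N) = 1"
      by (auto simp: has_bochner_integral_iff)
  qed
  have bounded: "integrable ?N h \<and> integral\<^sup>L ?N h \<le> R"
    if "(\<integral>\<^sup>+X. ennreal (h X) \<partial>?N) \<le> ennreal R" "\<And>X. 0 \<le> h X" and [measurable]: "h \<in> borel_measurable ?N"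
    for h :: "(nat \<Rightarrow> 'b) \<Rightarrow> real"
  proof -
    have i: "integrable ?N h"
      using that by (intro integrableI_nonneg) (auto intro: le_less_trans)
    then show ?thesis using that R(1) by (simp add: nn_integral_eq_integral)
  qed
  have 1: "integrable ?N (\<lambda>X. (f X - s)\<^sup>2)" "(\<integral>X. (f X - s)\<^sup>2 \<partial>?N) \<le> R"
    using bounded[of "\<lambda>X. (f X - s)\<^sup>2"] R(2) by auto
  have 2: "integrable ?N (\<lambda>X. (g X)\<^sup>2 * (f X - s')\<^sup>2)" "(\<integral>X. (g X)\<^sup>2 * (f X - s')\<^sup>2 \<partial>?N) \<le> R"
    using bounded[of "\<lambda>X. (g X)\<^sup>2 * (f X - s')\<^sup>2"] R(3) Q_eq[of "\<lambda>X. (f X - s')\<^sup>2"] by auto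
  have int1: "integrable ?N (\<lambda>X. \<bar>f X - s\<bar> * g X)"
    by (rule Bochner_Integration.integrable_bound[OF Bochner_Integration.integrable_add[OF 1(1) int_g2]])
      (use abs_mult_le_power2_sum[of "\<bar>f _ - s\<bar>" "g _"] in \<open>auto intro: order_trans[OF _ abs_ge_self]\<close>)
  have int2: "integrable ?N (\<lambda>X. \<bar>f X - s'\<bar> * g X)"
    by (rule Bochner_Integration.integrable_bound[OF Bochner_Integration.integrable_add[OF 2(1) N.integrable_const[of 1]]])
      (use abs_mult_le_power2_sum[of "\<bar>f _ - s'\<bar> * g _" 1] in \<open>auto simp: power_mult_distrib mult.commute intro: order_trans[OF _ abs_ge_self]\<close>)
  have I1: "(\<integral>X. \<bar>f X - s\<bar> * g X \<partial>?N) \<le> sqrt R"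
  proof -
    have "(\<integral>X. \<bar>f X - s\<bar> * g X \<partial>?N) \<le> sqrt (\<integral>X. \<bar>f X - s\<bar>\<^sup>2 \<partial>?N) * sqrt (\<integral>X. (g X)\<^sup>2 \<partial>?N)"
      using 1 int_g2 int1 by (intro integral_Cauchy_Schwarz) auto
    then show ?thesis using 1(2) by (auto simp: val_g2 intro: order_trans[OF _ real_sqrt_le_mono])
  qed
  have I2: "(\<integral>X. \<bar>f X - s'\<bar> * g X \<partial>?N) \<le> sqrt R"
  proof -
    \<comment> \<open>Here \<open>g\<close> stays with the error and the second factor is 1: the
      square of the first factor integrates under the first law to the risk under the
      second.\<close>
    have "(\<integral>X. (\<bar>f X - s'\<bar> * g X) * 1 \<partial>?N) \<le> sqrt (\<integral>X. (\<bar>f X - s'\<bar> * g X)\<^sup>2 \<partial>?N) * sqrt (\<integral>X. 1\<^sup>2 \<partial>?N)"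
      using 2 int2 by (intro integral_Cauchy_Schwarz) (auto simp: power_mult_distrib mult.commute)
    also have "(\<integral>X. (\<bar>f X - s'\<bar> * g X)\<^sup>2 \<partial>?N) = (\<integral>X. (g X)\<^sup>2 * (f X - s')\<^sup>2 \<partial>?N)"
      by (simp add: power_mult_distrib mult.commute)
    finally show ?thesis using 2(2) by (auto simp: N.prob_space intro: order_trans[OF _ real_sqrt_le_mono])
  qed
  have "\<bar>s - s'\<bar> * (\<integral>x. sqrt (L x) \<partial>M) ^ n = (\<integral>X. \<bar>s - s'\<bar> * g X \<partial>?N)"
    by (simp add: val_g)
  also have "\<dots> \<le> (\<integral>X. \<bar>f X - s\<bar> * g X + \<bar>f X - s'\<bar> * g X \<partial>?N)"
  proof (rule integral_mono)
    show "\<bar>s - s'\<bar> * g X \<le> \<bar>f X - s\<bar> * g X + \<bar>f X - s'\<bar> * g X" for X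
      unfolding distrib_right[symmetric] using g0 by (intro mult_right_mono) auto
  qed (use int1 int2 int_g in auto)
  also have "\<dots> \<le> 2 * sqrt R" using I1 I2 int1 int2 by simp
  finally show ?thesis .
qed

text \<open>Bias-variance decomposition: products at distinct indices have mean 0 by independence
  and centring, leaving \<open>n\<close> equal diagonal terms out of the double sum.\<close>

lemma iid_mean_square_error:
  fixes Z :: "'b \<Rightarrow> real"
  assumes "prob_space M" and Z: "integrable M Z" "integrable M (\<lambda>x. (Z x)\<^sup>2)" "integral\<^sup>L M Z = 0"
    and "1 \<le> n"
  shows "(\<integral>\<^sup>+X. ennreal (((1 / real n) * (\<Sum>i<n. Z (X i)) + \<beta>)\<^sup>2) \<partial>(\<Pi>\<^sub>M i\<in>{..<n}. M))
    = ennreal (\<beta>\<^sup>2 + (\<integral>x. (Z x)\<^sup>2 \<partial>M) / n)"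
proof -
  interpret prob_space M by fact
  interpret product_sigma_finite "\<lambda>_::nat. M" ..
  let ?N = "\<Pi>\<^sub>M i\<in>{..<n}. M"
  interpret N: prob_space ?N by (rule prob_space_PiM) (rule assms(1))
  let ?V = "\<integral>x. (Z x)\<^sup>2 \<partial>M"
  \<comment> \<open>The factor of \<open>Z (X i) * Z (X j)\<close> that depends on coordinate
    \<open>k\<close>. Writing it as a product of two conditionals covers \<open>i = j\<close>, where
    it becomes the square of \<open>Z x\<close>.\<close>
  define F where "F i j k x = (if k = i then Z x else 1) * (if k = j then Z x else 1)" for i j k :: nat and x
  have F: "Z (X i) * Z (X j) = (\<Prod>k<n. F i j k (X k))" if "i < n" "j < n" for i j X
    using that by (simp add: F_def prod.distrib prod.delta)
  have Fint: "integrable M (F i j k)" for i j k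
    using Z by (cases "k = i"; cases "k = j") (simp_all add: F_def[abs_def] power2_eq_square)
  have prod_int: "integrable ?N (\<lambda>X. Z (X i) * Z (X j))" if "i < n" "j < n" for i j
    unfolding F[OF that] by (rule product_integrable_prod) (auto intro: Fint)
  have prod_val: "(\<integral>X. Z (X i) * Z (X j) \<partial>?N) = (if i = j then ?V else 0)" if "i < n" "j < n" for i j
  proof -
    have "(\<integral>X. Z (X i) * Z (X j) \<partial>?N) = (\<Prod>k<n. integral\<^sup>L M (F i j k))"
      unfolding F[OF that] by (rule product_integral_prod) (auto intro: Fint)
    also have "\<dots> = (if i = j then ?V else 0)"
    proof (cases "i = j")
      case True
      have "(\<Prod>k<n. integral\<^sup>L M (F i j k)) = (\<Prod>k<n. if k = i then ?V else 1)"
        by (intro prod.cong) (auto simp: F_def[abs_def] True power2_eq_square prob_space)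
      then show ?thesis using True that by simp
    next
      case False
      then have "integral\<^sup>L M (F i j i) = 0" using Z by (simp add: F_def[abs_def])
      then show ?thesis using False that by auto
    qed
    finally show ?thesis .
  qed
  have one: "integrable ?N (\<lambda>X. Z (X i)) \<and> (\<integral>X. Z (X i) \<partial>?N) = 0" if "i < n" for i
  proof -
    have "Z (X i) = (\<Prod>k<n. (if k = i then Z else (\<lambda>_. 1)) (X k))" for X
      using that by (simp add: if_distribR prod.delta cong: if_cong)
    moreover have "integrable M (if k = i then Z else (\<lambda>_. 1))" for k using Z by auto
    moreover have "(\<Prod>k<n. integral\<^sup>L M (if k = i then Z else (\<lambda>_. 1))) = 0"
      using that Z by (intro prod_zero bexI[of _ i]) auto
    ultimately show ?thesis
      using product_integrable_prod[of "{..<n}" "\<lambda>k. if k = i then Z else (\<lambda>_. 1)"]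
        product_integral_prod[of "{..<n}" "\<lambda>k. if k = i then Z else (\<lambda>_. 1)"] by simp
  qed
  define c where "c = 1 / real n"
  have expand: "(c * (\<Sum>i<n. Z (X i)) + \<beta>)\<^sup>2 =
      c\<^sup>2 * (\<Sum>i<n. \<Sum>j<n. Z (X i) * Z (X j)) + 2 * c * \<beta> * (\<Sum>i<n. Z (X i)) + \<beta>\<^sup>2" for X
    by (simp add: sum_product[symmetric] power2_eq_square algebra_simps)
  have int2: "integrable ?N (\<lambda>X. \<Sum>i<n. \<Sum>j<n. Z (X i) * Z (X j))"
    using prod_int by (intro Bochner_Integration.integrable_sum) auto
  have int1: "integrable ?N (\<lambda>X. \<Sum>i<n. Z (X i))"
    using one by (intro Bochner_Integration.integrable_sum) auto
  have val2: "(\<integral>X. (\<Sum>i<n. \<Sum>j<n. Z (X i) * Z (X j)) \<partial>?N) = (\<Sum>i<n. \<Sum>j<n. if i = j then ?V else 0)"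
  proof -
    have "(\<integral>X. (\<Sum>i<n. \<Sum>j<n. Z (X i) * Z (X j)) \<partial>?N) = (\<Sum>i<n. \<integral>X. (\<Sum>j<n. Z (X i) * Z (X j)) \<partial>?N)"
      using prod_int by (intro Bochner_Integration.integral_sum Bochner_Integration.integrable_sum) auto
    also have "\<dots> = (\<Sum>i<n. \<Sum>j<n. \<integral>X. Z (X i) * Z (X j) \<partial>?N)"
      using prod_int by (intro sum.cong refl Bochner_Integration.integral_sum) auto
    also have "\<dots> = (\<Sum>i<n. \<Sum>j<n. if i = j then ?V else 0)"
      using prod_val by (intro sum.cong refl) auto
    finally show ?thesis .
  qed
  have val1: "(\<integral>X. (\<Sum>i<n. Z (X i)) \<partial>?N) = 0"
    using one by (simp add: Bochner_Integration.integral_sum)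
  have int: "integrable ?N (\<lambda>X. (c * (\<Sum>i<n. Z (X i)) + \<beta>)\<^sup>2)"
    unfolding expand using int1 int2 by (intro Bochner_Integration.integrable_add integrable_mult_right) auto
  have "(\<integral>X. (c * (\<Sum>i<n. Z (X i)) + \<beta>)\<^sup>2 \<partial>?N) = c\<^sup>2 * (\<Sum>i<n. \<Sum>j<n. if i = j then ?V else 0) + \<beta>\<^sup>2"
    unfolding expand using int1 int2
    by (simp add: val1 val2 N.prob_space del: Bochner_Integration.integral_sum sum.delta sum.delta')
  also have "\<dots> = \<beta>\<^sup>2 + ?V / n"
    using \<open>1 \<le> n\<close> by (simp add: c_def power2_eq_square field_simps)
  finally show ?thesis
    unfolding c_def using int by (subst nn_integral_eq_integral) (auto simp: c_def)
qed

lemma ennreal_sqrt_mono: "x \<le> y \<Longrightarrow> ennreal_sqrt x \<le> ennreal_sqrt y"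
  by (auto simp: ennreal_sqrt_def top_unique less_top intro!: ennreal_leI enn2real_mono)

lemma ennreal_sqrt_power2: "0 \<le> x \<Longrightarrow> ennreal_sqrt (ennreal (x\<^sup>2)) = ennreal x"
  by (simp add: ennreal_sqrt_def)

section \<open>Moments of an exponential family\<close>

locale exp_family =
  fixes d :: nat and \<nu> :: "'a measure" and \<phi> :: "'a \<Rightarrow> nat \<Rightarrow> real" and \<Gamma> :: "(nat \<Rightarrow> real) set"
  assumes d_pos: "1 \<le> d"
    and phi_measurable: "\<And>i. i < d \<Longrightarrow> (\<lambda>x. \<phi> x i) \<in> borel_measurable \<nu>"
    and open_params: "openin (Euclidean_space d) \<Gamma>"
    and convex_params: "seq_convex \<Gamma>"
    and finite_partition: "\<And>\<gamma>. \<gamma> \<in> \<Gamma> \<Longrightarrow> partition_fun d \<nu> \<phi> \<gamma> < \<infinity>"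
    and nondegenerate: "\<exists>\<gamma>0\<in>\<Gamma>. \<forall>a\<in>Rd d. a \<noteq> (\<lambda>_. 0) \<longrightarrow>
        prob_space.variance (ef_dist d \<nu> \<phi> \<gamma>0) (\<lambda>x. dot d (\<phi> x) a) > 0"
begin

abbreviation P where "P \<equiv> ef_dist d \<nu> \<phi>"
abbreviation C where "C \<equiv> log_partition d \<nu> \<phi>"
abbreviation mean where "mean \<equiv> mean_map d \<nu> \<phi>"

definition var_dot :: "(nat \<Rightarrow> real) \<Rightarrow> (nat \<Rightarrow> real) \<Rightarrow> real"
  where "var_dot \<gamma> a = prob_space.variance (P \<gamma>) (\<lambda>x. dot d a (\<phi> x))"

abbreviation sd where "sd \<gamma> a \<equiv> sqrt (var_dot \<gamma> a)"

text \<open>The envelope for all linear statistics: one exponential moment of it controls every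
  polynomial moment.\<close>

definition norm1 :: "'a \<Rightarrow> real"
  where "norm1 x = (\<Sum>i<d. \<bar>\<phi> x i\<bar>)"

lemma params_subset: "\<gamma> \<in> \<Gamma> \<Longrightarrow> \<gamma> \<in> Rd d"
  using open_params openin_subset by blast

lemma dot_measurable [measurable]: "(\<lambda>x. dot d a (\<phi> x)) \<in> borel_measurable \<nu>"
  unfolding dot_def using phi_measurable by (intro borel_measurable_sum borel_measurable_times) auto

lemma norm1_measurable [measurable]: "norm1 \<in> borel_measurable \<nu>"
  unfolding norm1_def[abs_def] using phi_measurable by (intro borel_measurable_sum borel_measurable_abs) auto

lemma ef_density_measurable [measurable]: "ef_density d \<nu> \<phi> \<gamma> \<in> borel_measurable \<nu>"
  unfolding ef_density_def[abs_def] by measurable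

lemma sets_P [measurable_cong, simp]: "sets (P \<gamma>) = sets \<nu>"
  by (simp add: ef_dist_def)

lemma space_P [simp]: "space (P \<gamma>) = space \<nu>"
  by (simp add: ef_dist_def)

text \<open>The densities are exponentials and hence nowhere zero.\<close>

lemma AE_P_iff: "(AE x in P \<gamma>. Q x) \<longleftrightarrow> (AE x in \<nu>. Q x)"
  unfolding ef_dist_def by (subst AE_density) (auto simp: ef_density_def)

text \<open>If it vanished, \<open>\<nu>\<close> would be null and every variance 0, against
  nondegeneracy in the direction of the first unit vector, which exists because
  \<open>1 \<le> d\<close>.\<close>

lemma partition_pos:
  assumes "\<gamma> \<in> \<Gamma>"
  shows "0 < partition_fun d \<nu> \<phi> \<gamma>"
proof (rule ccontr)
  assume "\<not> ?thesis"
  then have "partition_fun d \<nu> \<phi> \<gamma> = 0" by simp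
  then have "AE x in \<nu>. ennreal (exp (dot d \<gamma> (\<phi> x))) = 0"
    unfolding partition_fun_def by (subst (asm) nn_integral_0_iff_AE) auto
  then have null: "AE x in \<nu>. False" by simp
  have zero: "integral\<^sup>L (P \<gamma>') f = 0" for \<gamma>' and f :: "'a \<Rightarrow> real"
    by (intro integral_eq_zero_AE) (use null in \<open>auto simp: AE_P_iff elim: AE_mp\<close>)
  obtain \<gamma>0 where "\<forall>a\<in>Rd d. a \<noteq> (\<lambda>_. 0) \<longrightarrow> prob_space.variance (P \<gamma>0) (\<lambda>x. dot d (\<phi> x) a) > 0"
    using nondegenerate by blast
  from this[rule_format, of "\<lambda>i. if i = 0 then 1 else 0"] show False
    using d_pos by (simp add: zero in_Rd_iff) (metis zero_neq_one)
qed

lemma exp_C: "\<gamma> \<in> \<Gamma> \<Longrightarrow> ennreal (exp (C \<gamma>)) = partition_fun d \<nu> \<phi> \<gamma>"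
  using partition_pos[of \<gamma>] finite_partition[of \<gamma>]
  by (simp add: log_partition_def enn2real_positive_iff less_top)

lemma prob_space_P:
  assumes "\<gamma> \<in> \<Gamma>"
  shows "prob_space (P \<gamma>)"
proof
  have "emeasure (P \<gamma>) (space (P \<gamma>)) = (\<integral>\<^sup>+x. ennreal (ef_density d \<nu> \<phi> \<gamma> x) \<partial>\<nu>)"
    unfolding ef_dist_def by (subst emeasure_density) (auto intro!: nn_integral_cong)
  also have "\<dots> = (\<integral>\<^sup>+x. ennreal (exp (- C \<gamma>)) * ennreal (exp (dot d \<gamma> (\<phi> x))) \<partial>\<nu>)"
    by (simp add: ef_density_def exp_diff exp_minus ennreal_mult'[symmetric] field_simps)
  also have "\<dots> = ennreal (exp (- C \<gamma>)) * ennreal (exp (C \<gamma>))"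
    unfolding exp_C[OF assms] partition_fun_def by (rule nn_integral_cmult) simp
  also have "\<dots> = 1"
    by (simp add: ennreal_mult'[symmetric] flip: exp_add)
  finally show "emeasure (P \<gamma>) (space (P \<gamma>)) = 1" .
qed

lemma prob_P [simp]: "\<gamma> \<in> \<Gamma> \<Longrightarrow> measure (P \<gamma>) (space \<nu>) = 1"
  using prob_space.prob_space[OF prob_space_P] by simp

lemma P_change:
  "P \<gamma>' = density (P \<gamma>) (\<lambda>x. ennreal (exp (dot d (\<lambda>i. \<gamma>' i - \<gamma> i) (\<phi> x) - (C \<gamma>' - C \<gamma>))))"
  unfolding ef_dist_def
  by (subst density_density_eq)
    (auto simp: ef_density_def dot_diff ennreal_mult'[symmetric] simp flip: exp_add intro!: density_cong)

lemma integrable_P_change: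
  fixes f :: "'a \<Rightarrow> real"
  assumes "f \<in> borel_measurable \<nu>"
  shows "integrable (P \<gamma>') f \<longleftrightarrow>
      integrable (P \<gamma>) (\<lambda>x. exp (dot d (\<lambda>i. \<gamma>' i - \<gamma> i) (\<phi> x) - (C \<gamma>' - C \<gamma>)) * f x)"
  unfolding P_change[of \<gamma>' \<gamma>] using assms by (subst integrable_density) auto

lemma integral_P_change:
  fixes f :: "'a \<Rightarrow> real"
  assumes "f \<in> borel_measurable \<nu>"
  shows "integral\<^sup>L (P \<gamma>') f =
      (\<integral>x. exp (dot d (\<lambda>i. \<gamma>' i - \<gamma> i) (\<phi> x) - (C \<gamma>' - C \<gamma>)) * f x \<partial>P \<gamma>)"
  unfolding P_change[of \<gamma>' \<gamma>] using assms by (subst integral_density) auto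

lemma likelihood_ratio_integrable:
  assumes "\<gamma>' \<in> \<Gamma>"
  shows "integrable (P \<gamma>) (\<lambda>x. exp (dot d (\<lambda>i. \<gamma>' i - \<gamma> i) (\<phi> x) - (C \<gamma>' - C \<gamma>)))"
    and "(\<integral>x. exp (dot d (\<lambda>i. \<gamma>' i - \<gamma> i) (\<phi> x) - (C \<gamma>' - C \<gamma>)) \<partial>P \<gamma>) = 1"
proof -
  interpret prob_space "P \<gamma>'" by (rule prob_space_P[OF assms])
  show "integrable (P \<gamma>) (\<lambda>x. exp (dot d (\<lambda>i. \<gamma>' i - \<gamma> i) (\<phi> x) - (C \<gamma>' - C \<gamma>)))"
    using integrable_P_change[of "\<lambda>_. 1" \<gamma>' \<gamma>] by simp
  show "(\<integral>x. exp (dot d (\<lambda>i. \<gamma>' i - \<gamma> i) (\<phi> x) - (C \<gamma>' - C \<gamma>)) \<partial>P \<gamma>) = 1"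
    using integral_P_change[of "\<lambda>_. 1" \<gamma>' \<gamma>] assms by simp
qed

text \<open>Up to a constant factor the integrand is the likelihood ratio of the member at
  \<open>\<gamma> + y\<close> against the one at \<open>\<gamma>\<close>.\<close>

lemma exp_dot_integrable:
  assumes "(\<lambda>i. \<gamma> i + y i) \<in> \<Gamma>"
  shows "integrable (P \<gamma>) (\<lambda>x. exp (dot d y (\<phi> x)))"
proof -
  define \<kappa> where "\<kappa> = C (\<lambda>i. \<gamma> i + y i) - C \<gamma>"
  have "integrable (P \<gamma>) (\<lambda>x. exp \<kappa> * exp (dot d y (\<phi> x) - \<kappa>))"
    using likelihood_ratio_integrable(1)[OF assms, of \<gamma>] by (simp add: \<kappa>_def)
  then show ?thesis by (simp flip: exp_add)
qed

text \<open>A box around \<open>\<gamma>\<close> lies in the open set \<open>\<Gamma>\<close>, so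
  exponentials of single coordinates are integrable at rates up to \<open>R\<close>. Some coordinate
  carries at least the fraction \<open>1 / d\<close> of \<open>norm1 x\<close>, whence the rate
  \<open>R / d\<close>.\<close>

lemma exp_norm1_integrable:
  assumes "\<gamma> \<in> \<Gamma>"
  shows "\<exists>r>0. integrable (P \<gamma>) (\<lambda>x. exp (r * norm1 x))"
proof -
  obtain R where R: "R > 0" "\<And>y. y \<in> Rd d \<Longrightarrow> (\<forall>i<d. \<bar>y i\<bar> \<le> R) \<Longrightarrow> (\<lambda>i. \<gamma> i + y i) \<in> \<Gamma>"
    using openin_Euclidean_space_contains_box[OF open_params assms] by blast
  define G where "G x = (\<Sum>k<d. exp (R * \<phi> x k) + exp (- R * \<phi> x k))" for x
  have "integrable (P \<gamma>) (\<lambda>x. exp (s * \<phi> x k))" if "k < d" "\<bar>s\<bar> \<le> R" for k s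
  proof -
    have "integrable (P \<gamma>) (\<lambda>x. exp (dot d (\<lambda>i. if i = k then s else 0) (\<phi> x)))"
      using that R(1) by (intro exp_dot_integrable R(2)) (auto simp: in_Rd_iff)
    then show ?thesis using that by (simp add: dot_unit)
  qed
  from this[of _ R] this[of _ "- R"] have G: "integrable (P \<gamma>) G"
    unfolding G_def[abs_def] using R(1) by (intro Bochner_Integration.integrable_sum Bochner_Integration.integrable_add) auto
  have "exp (R / d * norm1 x) \<le> G x" for x
  proof -
    have "\<exists>k<d. norm1 x \<le> d * \<bar>\<phi> x k\<bar>"
    proof (rule ccontr)
      assume "\<not> ?thesis"
      then have "(\<Sum>k<d. d * \<bar>\<phi> x k\<bar>) < (\<Sum>k<d. norm1 x)"
        using d_pos by (intro sum_strict_mono) (auto simp: not_le lessThan_empty_iff)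
      then show False by (simp add: norm1_def sum_distrib_left)
    qed
    then obtain k where k: "k < d" "norm1 x \<le> d * \<bar>\<phi> x k\<bar>" by blast
    have "R / d * norm1 x \<le> R / d * (d * \<bar>\<phi> x k\<bar>)"
      using R(1) k by (intro mult_left_mono) auto
    also have "\<dots> = R * \<bar>\<phi> x k\<bar>" using d_pos by simp
    finally have "exp (R / d * norm1 x) \<le> exp (R * \<bar>\<phi> x k\<bar>)" by simp
    also have "\<dots> \<le> exp (R * \<phi> x k) + exp (- R * \<phi> x k)"
      by (cases "\<phi> x k \<ge> 0") (auto simp: abs_if add_increasing add_increasing2)
    also have "\<dots> \<le> G x"
      unfolding G_def using k(1) by (intro member_le_sum[where f = "\<lambda>k. exp (R * \<phi> x k) + exp (- R * \<phi> x k)"]) auto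
    finally show ?thesis .
  qed
  then have "integrable (P \<gamma>) (\<lambda>x. exp (R / d * norm1 x))"
    by (intro Bochner_Integration.integrable_bound[OF G]) (auto intro: order_trans[OF _ abs_ge_self])
  then show ?thesis using R(1) d_pos by (intro exI[of _ "R / d"]) auto
qed

text \<open>Any power is dominated by a constant times an exponential of arbitrarily small rate, in
  particular of a rate \<open>r\<close> at which the exponential is integrable.\<close>

lemma polynomial_growth_integrable:
  fixes f :: "'a \<Rightarrow> real"
  assumes "\<gamma> \<in> \<Gamma>" and f: "f \<in> borel_measurable \<nu>"
    and bound: "\<And>x. \<bar>f x\<bar> \<le> K * (A + norm1 x) ^ k" and "0 \<le> A" "0 \<le> K"
  shows "integrable (P \<gamma>) f"
proof -
  obtain r where r: "r > 0" "integrable (P \<gamma>) (\<lambda>x. exp (r * norm1 x))"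
    using exp_norm1_integrable[OF assms(1)] by blast
  have n: "0 \<le> norm1 x" for x by (auto simp: norm1_def sum_nonneg)
  define B where "B = K * (fact k / r ^ k) * exp (r * A)"
  have "\<bar>f x\<bar> \<le> B * exp (r * norm1 x)" for x
  proof -
    have "(r * (A + norm1 x)) ^ k \<le> fact k * exp (r * (A + norm1 x))"
      using n[of x] r(1) \<open>0 \<le> A\<close> by (intro power_le_fact_mult_exp) auto
    then have "(A + norm1 x) ^ k \<le> fact k / r ^ k * exp (r * (A + norm1 x))"
      using r(1) by (simp only: power_mult_distrib) (simp add: field_simps)
    then have "K * (A + norm1 x) ^ k \<le> K * (fact k / r ^ k * exp (r * (A + norm1 x)))"
      using \<open>0 \<le> K\<close> by (rule mult_left_mono)
    with bound[of x] show ?thesis by (simp add: B_def distrib_left exp_add mult.assoc)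
  qed
  then show ?thesis
    by (intro Bochner_Integration.integrable_bound[OF integrable_mult_right[OF r(2), of B]])
      (use f in \<open>auto intro: order_trans[OF _ abs_ge_self]\<close>)
qed

lemma abs_dot_norm1_le: "\<bar>dot d a (\<phi> x)\<bar> \<le> (\<Sum>i<d. \<bar>a i\<bar>) * norm1 x"
proof -
  have "\<bar>a i\<bar> \<le> (\<Sum>i<d. \<bar>a i\<bar>)" if "i < d" for i
    using that by (intro member_le_sum) auto
  then show ?thesis unfolding norm1_def by (rule abs_dot_le)
qed

lemma dot_power_integrable:
  assumes "\<gamma> \<in> \<Gamma>"
  shows "integrable (P \<gamma>) (\<lambda>x. (dot d a (\<phi> x) + b) ^ k)"
proof (rule polynomial_growth_integrable[OF assms])
  fix x
  \<comment> \<open>The summand 1 gives \<open>s \<ge> 1\<close>, so that \<open>s\<close> absorbs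
    the constant \<open>b\<close> as well.\<close>
  define s where "s = 1 + (\<Sum>i<d. \<bar>a i\<bar>)"
  have s: "s \<ge> 1" by (auto simp: s_def sum_nonneg)
  have "\<bar>dot d a (\<phi> x) + b\<bar> \<le> (\<Sum>i<d. \<bar>a i\<bar>) * norm1 x + \<bar>b\<bar>"
    using abs_dot_norm1_le[of a x] by linarith
  also have "\<dots> \<le> s * norm1 x + s * \<bar>b\<bar>"
    using s by (intro add_mono mult_right_mono) (auto simp: s_def norm1_def sum_nonneg mult_le_cancel_right1)
  finally have "\<bar>dot d a (\<phi> x) + b\<bar> \<le> s * (\<bar>b\<bar> + norm1 x)" by (simp add: algebra_simps)
  then have "\<bar>dot d a (\<phi> x) + b\<bar> ^ k \<le> (s * (\<bar>b\<bar> + norm1 x)) ^ k"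
    by (intro power_mono) auto
  then show "\<bar>(dot d a (\<phi> x) + b) ^ k\<bar> \<le> (1 + (\<Sum>i<d. \<bar>a i\<bar>)) ^ k * (\<bar>b\<bar> + norm1 x) ^ k"
    by (simp add: power_abs power_mult_distrib s_def)
qed (auto simp: sum_nonneg)

lemma dot_integrable: "\<gamma> \<in> \<Gamma> \<Longrightarrow> integrable (P \<gamma>) (\<lambda>x. dot d a (\<phi> x))"
  using dot_power_integrable[of \<gamma> a 0 1] by simp

lemma coordinate_integrable: "\<gamma> \<in> \<Gamma> \<Longrightarrow> k < d \<Longrightarrow> integrable (P \<gamma>) (\<lambda>x. \<phi> x k)"
  using dot_integrable[of \<gamma> "\<lambda>i. if i = k then 1 else 0"] by (simp add: dot_unit)

section \<open>Means and covariances of linear statistics\<close>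

lemma expectation_dot:
  assumes "\<gamma> \<in> \<Gamma>"
  shows "(\<integral>x. dot d a (\<phi> x) \<partial>P \<gamma>) = dot d a (mean \<gamma>)"
  unfolding dot_def mean_map_def using coordinate_integrable[OF assms]
  by (subst Bochner_Integration.integral_sum) (auto intro!: sum.cong)

lemma var_dot_eq:
  assumes "\<gamma> \<in> \<Gamma>"
  shows "var_dot \<gamma> a = (\<integral>x. (dot d a (\<phi> x) - dot d a (mean \<gamma>))\<^sup>2 \<partial>P \<gamma>)"
  by (simp add: var_dot_def expectation_dot[OF assms])

lemma var_dot_nonneg: "0 \<le> var_dot \<gamma> a"
  by (simp add: var_dot_def)

definition cov_dot :: "(nat \<Rightarrow> real) \<Rightarrow> (nat \<Rightarrow> real) \<Rightarrow> (nat \<Rightarrow> real) \<Rightarrow> real"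
  where "cov_dot \<gamma> a b =
    (\<integral>x. (dot d a (\<phi> x) - dot d a (mean \<gamma>)) * (dot d b (\<phi> x) - dot d b (mean \<gamma>)) \<partial>P \<gamma>)"

lemma cov_dot_self: "\<gamma> \<in> \<Gamma> \<Longrightarrow> cov_dot \<gamma> a a = var_dot \<gamma> a"
  by (simp add: cov_dot_def var_dot_eq power2_eq_square)

lemma centered_square_integrable:
  "\<gamma> \<in> \<Gamma> \<Longrightarrow> integrable (P \<gamma>) (\<lambda>x. (dot d a (\<phi> x) - dot d a (mean \<gamma>))\<^sup>2)"
  using dot_power_integrable[of \<gamma> a "- dot d a (mean \<gamma>)" 2] by simp

lemma centered_product_integrable:
  assumes "\<gamma> \<in> \<Gamma>"
  shows "integrable (P \<gamma>) (\<lambda>x. (dot d a (\<phi> x) - dot d a (mean \<gamma>)) * (dot d b (\<phi> x) - dot d b (mean \<gamma>)))"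
proof (rule Bochner_Integration.integrable_bound)
  show "integrable (P \<gamma>) (\<lambda>x. (dot d a (\<phi> x) - dot d a (mean \<gamma>))\<^sup>2 + (dot d b (\<phi> x) - dot d b (mean \<gamma>))\<^sup>2)"
    using assms by (intro Bochner_Integration.integrable_add centered_square_integrable)
  show "AE x in P \<gamma>. norm ((dot d a (\<phi> x) - dot d a (mean \<gamma>)) * (dot d b (\<phi> x) - dot d b (mean \<gamma>)))
      \<le> norm ((dot d a (\<phi> x) - dot d a (mean \<gamma>))\<^sup>2 + (dot d b (\<phi> x) - dot d b (mean \<gamma>))\<^sup>2)"
    by (simp add: abs_mult_le_power2_sum)
qed simp

lemma cov_dot_le:
  assumes "\<gamma> \<in> \<Gamma>"
  shows "cov_dot \<gamma> a b \<le> sd \<gamma> a * sd \<gamma> b"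
  unfolding cov_dot_def var_dot_eq[OF assms] using assms
  by (intro integral_Cauchy_Schwarz centered_square_integrable centered_product_integrable)

text \<open>Covariance with \<open>a\<close> becomes the pairing with an explicit vector; after
  normalisation this vector is the support vector used in \<open>sd_support\<close>.\<close>

lemma cov_dot_expand:
  assumes "\<gamma> \<in> \<Gamma>"
  shows "cov_dot \<gamma> b a = dot d b (\<lambda>i. cov_dot \<gamma> (\<lambda>j. if j = i then 1 else 0) a)"
proof -
  let ?e = "\<lambda>i j. if j = i then 1 else 0 :: real"
  have e: "dot d b y = (\<Sum>i<d. b i * dot d (?e i) y)" for y
    unfolding dot_def[of d b] by (intro sum.cong) (auto simp: dot_unit)
  have "cov_dot \<gamma> b a = (\<integral>x. (\<Sum>i<d. b i * ((dot d (?e i) (\<phi> x) - dot d (?e i) (mean \<gamma>)) * (dot d a (\<phi> x) - dot d a (mean \<gamma>)))) \<partial>P \<gamma>)"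
    unfolding cov_dot_def e[of "\<phi> _"] e[of "mean \<gamma>"]
    by (simp only: sum_subtractf[symmetric] sum_distrib_right right_diff_distrib[symmetric] mult.assoc)
  also have "\<dots> = dot d b (\<lambda>i. cov_dot \<gamma> (?e i) a)"
    unfolding cov_dot_def dot_def[of d b] using centered_product_integrable[OF assms]
    by (subst Bochner_Integration.integral_sum) auto
  finally show ?thesis .
qed

lemma cov_dot_commute: "cov_dot \<gamma> a b = cov_dot \<gamma> b a"
  by (simp add: cov_dot_def mult.commute)

text \<open>Zero variance says that the statistic is almost everywhere constant. Since all members
  share their null sets, it would then have zero variance at the nondegenerate parameter
  too.\<close>

lemma var_dot_pos:
  assumes "\<gamma> \<in> \<Gamma>" "a \<in> Rd d" "a \<noteq> (\<lambda>_. 0)"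
  shows "0 < var_dot \<gamma> a"
proof (rule ccontr)
  assume "\<not> ?thesis"
  then have "(\<integral>x. (dot d a (\<phi> x) - dot d a (mean \<gamma>))\<^sup>2 \<partial>P \<gamma>) = 0"
    using var_dot_nonneg[of \<gamma> a] unfolding var_dot_eq[OF assms(1)] by linarith
  then have AE: "AE x in \<nu>. dot d a (\<phi> x) = dot d a (mean \<gamma>)"
    using integral_nonneg_eq_0_iff_AE[OF centered_square_integrable[OF assms(1)]] by (simp add: AE_P_iff)
  obtain \<gamma>0 where \<gamma>0: "\<gamma>0 \<in> \<Gamma>" "prob_space.variance (P \<gamma>0) (\<lambda>x. dot d (\<phi> x) a) > 0"
    using nondegenerate assms by blast
  interpret prob_space "P \<gamma>0" by (rule prob_space_P) fact
  have "(\<integral>x. dot d a (\<phi> x) \<partial>P \<gamma>0) = (\<integral>x. dot d a (mean \<gamma>) \<partial>P \<gamma>0)"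
    using AE by (intro integral_cong_AE) (auto simp: AE_P_iff)
  also have "\<dots> = dot d a (mean \<gamma>)" by (simp add: \<gamma>0)
  finally have "(\<integral>x. (dot d a (\<phi> x) - integral\<^sup>L (P \<gamma>0) (\<lambda>x. dot d a (\<phi> x)))\<^sup>2 \<partial>P \<gamma>0) = 0"
    using AE by (intro integral_eq_zero_AE) (auto simp: AE_P_iff)
  with \<gamma>0(2) show False by (simp add: dot_commute[of d _ a])
qed

text \<open>The variance is a positive definite quadratic form with the covariance matrix as
  coefficients, so \<open>positive_form_lower_bound\<close> applies.\<close>

lemma coordinate_le_sd:
  assumes "\<gamma> \<in> \<Gamma>"
  shows "\<exists>c>0. \<forall>a\<in>Rd d. \<forall>k<d. c * \<bar>a k\<bar> \<le> sd \<gamma> a"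
proof -
  let ?e = "\<lambda>i j. if j = i then 1 else 0 :: real"
  have form: "var_dot \<gamma> a = (\<Sum>i<d. \<Sum>j<d. a i * a j * cov_dot \<gamma> (?e j) (?e i))" for a
  proof -
    have "var_dot \<gamma> a = (\<Sum>i<d. a i * (\<Sum>j<d. a j * cov_dot \<gamma> (?e j) (?e i)))"
      unfolding cov_dot_self[OF assms, symmetric] cov_dot_expand[OF assms, of a a] dot_def[of d a]
      by (subst cov_dot_commute, subst cov_dot_expand[OF assms]) (simp add: dot_def)
    then show ?thesis by (simp add: sum_distrib_left mult.assoc)
  qed
  obtain c where c: "c > 0" "\<And>a. a \<in> Rd d \<Longrightarrow> c * (\<Sum>i<d. (a i)\<^sup>2) \<le> var_dot \<gamma> a"
    using positive_form_lower_bound[of d "\<lambda>i j. cov_dot \<gamma> (?e j) (?e i)"] var_dot_pos[OF assms] unfolding form by blast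
  have "sqrt c * \<bar>a k\<bar> \<le> sd \<gamma> a" if "a \<in> Rd d" "k < d" for a k
  proof -
    have "(a k)\<^sup>2 \<le> (\<Sum>i<d. (a i)\<^sup>2)" using that(2) by (intro member_le_sum) auto
    then have "c * (a k)\<^sup>2 \<le> var_dot \<gamma> a"
      using c that by (meson less_imp_le mult_left_mono order_trans)
    then have "sqrt (c * (a k)\<^sup>2) \<le> sd \<gamma> a" by simp
    then show ?thesis by (simp add: real_sqrt_mult)
  qed
  with c(1) show ?thesis by (intro exI[of _ "sqrt c"]) auto
qed

section \<open>Jeffreys divergence and Hellinger distance\<close>

text \<open>The symmetrised Kullback--Leibler divergence of \<^term>\<open>P \<gamma>\<close> and \<^term>\<open>P \<gamma>'\<close>.\<close>

definition jeffreys :: "(nat \<Rightarrow> real) \<Rightarrow> (nat \<Rightarrow> real) \<Rightarrow> real"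
  where "jeffreys \<gamma> \<gamma>' = dot d (\<lambda>i. \<gamma>' i - \<gamma> i) (\<lambda>i. mean \<gamma>' i - mean \<gamma> i)"

lemma integral_P:
  fixes f :: "'a \<Rightarrow> real"
  assumes "f \<in> borel_measurable \<nu>"
  shows "integral\<^sup>L (P \<gamma>) f = (\<integral>x. ef_density d \<nu> \<phi> \<gamma> x * f x \<partial>\<nu>)"
  unfolding ef_dist_def using assms by (subst integral_density) (auto simp: ef_density_def)

lemma integrable_P:
  fixes f :: "'a \<Rightarrow> real"
  assumes "f \<in> borel_measurable \<nu>"
  shows "integrable (P \<gamma>) f \<longleftrightarrow> integrable \<nu> (\<lambda>x. ef_density d \<nu> \<phi> \<gamma> x * f x)"
  unfolding ef_dist_def using assms by (subst integrable_density) (auto simp: ef_density_def)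

text \<open>The scalar inequality is integrated with \<open>X\<close> the log-likelihood ratio. The
  result is the difference of the means of \<open>X\<close> under the two laws, in which the
  normalising constants cancel.\<close>

lemma hellinger_square_le_jeffreys:
  assumes "\<gamma> \<in> \<Gamma>" "\<gamma>' \<in> \<Gamma>"
  shows "(hellinger \<nu> (ef_density d \<nu> \<phi> \<gamma>) (ef_density d \<nu> \<phi> \<gamma>'))\<^sup>2 \<le> jeffreys \<gamma> \<gamma>'"
proof -
  let ?p = "ef_density d \<nu> \<phi> \<gamma>" and ?q = "ef_density d \<nu> \<phi> \<gamma>'"
  interpret P: prob_space "P \<gamma>" by (rule prob_space_P) fact
  interpret P': prob_space "P \<gamma>'" by (rule prob_space_P) fact
  define X where "X x = dot d (\<lambda>i. \<gamma>' i - \<gamma> i) (\<phi> x) - (C \<gamma>' - C \<gamma>)" for x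
  have X: "X \<in> borel_measurable \<nu>" unfolding X_def[abs_def] by measurable
  have int: "integrable (P \<theta>) X" if "\<theta> \<in> \<Gamma>" for \<theta>
    unfolding X_def[abs_def] diff_conv_add_uminus using dot_power_integrable[OF that, of _ _ 1] by simp
  have E: "integral\<^sup>L (P \<theta>) X = dot d (\<lambda>i. \<gamma>' i - \<gamma> i) (mean \<theta>) - (C \<gamma>' - C \<gamma>)" if "\<theta> \<in> \<Gamma>" for \<theta>
  proof -
    interpret prob_space "P \<theta>" by (rule prob_space_P) fact
    show ?thesis
      unfolding X_def[abs_def] using dot_integrable[OF that]
      by (subst Bochner_Integration.integral_diff) (simp_all add: expectation_dot[OF that] that)
  qed
  have "(hellinger \<nu> ?p ?q)\<^sup>2 = (\<integral>x. (sqrt (?p x) - sqrt (?q x))\<^sup>2 \<partial>\<nu>)"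
    by (simp add: hellinger_def)
  also have "\<dots> \<le> (\<integral>x. ?q x * X x - ?p x * X x \<partial>\<nu>)"
  proof -
    have le: "(sqrt (?p x) - sqrt (?q x))\<^sup>2 \<le> ?q x * X x - ?p x * X x" for x
    proof -
      define y z where "y = dot d \<gamma>' (\<phi> x) - C \<gamma>'" and "z = dot d \<gamma> (\<phi> x) - C \<gamma>"
      have "X x = y - z" by (simp add: X_def y_def z_def dot_diff)
      moreover have "?q x = exp y" "?p x = exp z" by (simp_all add: ef_density_def y_def z_def)
      ultimately show ?thesis
        using exp_half_diff_square_le[of y z] by (simp add: sqrt_exp power2_commute[of "exp (z / 2)"] left_diff_distrib)
    qed
    show ?thesis
      using int assms X by (intro integral_mono' Bochner_Integration.integrable_diff le order_trans[OF _ le])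
        (auto simp: integrable_P)
  qed
  also have "\<dots> = integral\<^sup>L (P \<gamma>') X - integral\<^sup>L (P \<gamma>) X"
    using int assms X by (simp add: integrable_P integral_P)
  also have "\<dots> = jeffreys \<gamma> \<gamma>'"
    by (simp add: E assms jeffreys_def dot_diff)
  finally show ?thesis .
qed

text \<open>In other words, the mean map is monotone.\<close>

lemma jeffreys_nonneg: "\<gamma> \<in> \<Gamma> \<Longrightarrow> \<gamma>' \<in> \<Gamma> \<Longrightarrow> 0 \<le> jeffreys \<gamma> \<gamma>'"
  using hellinger_square_le_jeffreys[of \<gamma> \<gamma>'] zero_le_power2 order_trans by blast

section \<open>Lower bounds for the Jeffreys divergence\<close>

lemma abs_centered_dot_le:
  assumes "\<And>i. i < d \<Longrightarrow> \<bar>y i\<bar> \<le> q"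
  shows "\<bar>dot d y (\<phi> x) - dot d y (mean \<gamma>)\<bar> \<le> q * ((\<Sum>i<d. \<bar>mean \<gamma> i\<bar>) + norm1 x)"
proof -
  have "\<bar>dot d y (\<phi> x) - dot d y (mean \<gamma>)\<bar> \<le> q * (\<Sum>i<d. \<bar>\<phi> x i - mean \<gamma> i\<bar>)"
    unfolding dot_diff[symmetric] using assms by (rule abs_dot_le)
  also have "\<dots> \<le> q * (\<Sum>i<d. \<bar>mean \<gamma> i\<bar> + \<bar>\<phi> x i\<bar>)"
  proof (rule mult_left_mono)
    show "0 \<le> q" using assms[of 0] d_pos by fastforce
  qed (intro sum_mono, arith)
  finally show ?thesis by (simp add: sum.distrib norm1_def)
qed

lemma exp_small_moment:
  assumes "\<gamma> \<in> \<Gamma>"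
  shows "\<exists>r>0. integrable (P \<gamma>) (\<lambda>x. exp (r * (A + norm1 x))) \<and>
    (\<integral>x. exp (r * (A + norm1 x)) \<partial>P \<gamma>) \<le> 2"
proof -
  interpret prob_space "P \<gamma>" by (rule prob_space_P) fact
  obtain s where s: "s > 0" "integrable (P \<gamma>) (\<lambda>x. exp (s * norm1 x))"
    using exp_norm1_integrable[OF assms] by blast
  have int: "integrable (P \<gamma>) (\<lambda>x. exp (s * (A + norm1 x)))"
    using integrable_mult_right[OF s(2), of "exp (s * A)"] by (simp add: distrib_left exp_add)
  define G where "G = (\<integral>x. exp (s * (A + norm1 x)) \<partial>P \<gamma>)"
  have "G \<ge> 0" by (simp add: G_def)
  \<comment> \<open>Shrinking the rate from \<open>s\<close> to \<open>u * s\<close> costs, by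
    convexity of the exponential, a moment of at most \<open>1 - u + u * G\<close>, and this
    \<open>u\<close> makes \<open>u * G \<le> 1\<close>.\<close>
  define u where "u = 1 / (1 + G)"
  have u: "0 < u" "u \<le> 1" "u * G \<le> 1" using \<open>G \<ge> 0\<close> by (auto simp: u_def field_simps)
  have conv: "exp (u * s * (A + norm1 x)) \<le> (1 - u) + u * exp (s * (A + norm1 x))" for x
    using convex_onD[OF exp_convex, of u 0 "s * (A + norm1 x)"] u by (simp add: mult.assoc)
  have int': "integrable (P \<gamma>) (\<lambda>x. exp (u * s * (A + norm1 x)))"
    by (rule Bochner_Integration.integrable_bound[of _ "\<lambda>x. (1 - u) + u * exp (s * (A + norm1 x))"])
      (use int conv in \<open>auto intro!: always_eventually order_trans[OF conv abs_ge_self]\<close>)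
  have "(\<integral>x. exp (u * s * (A + norm1 x)) \<partial>P \<gamma>) \<le> (\<integral>x. (1 - u) + u * exp (s * (A + norm1 x)) \<partial>P \<gamma>)"
    using int int' conv by (intro integral_mono) auto
  also have "\<dots> = 1 - u + u * G"
    using int by (subst Bochner_Integration.integral_add) (auto simp: G_def assms)
  also have "\<dots> \<le> 2" using u by simp
  finally show ?thesis using u s int' by (intro exI[of _ "u * s"]) auto
qed

text \<open>Under the law at \<open>\<gamma>\<close> the divergence is \<open>w\<close> times the
  mean of \<open>Z * (exp Z - 1)\<close>. The exponential moment gives \<open>w \<ge> 1 / 2\<close>,
  and the polynomial minorant leaves at least \<open>3 / 4 - 1 / 4 = 1 / 2\<close> of the
  variance.\<close>

lemma jeffreys_ge_of_moments:
  assumes \<gamma>: "\<gamma> \<in> \<Gamma>" and y: "(\<lambda>i. \<gamma> i + y i) \<in> \<Gamma>"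
    and int: "integrable (P \<gamma>) (\<lambda>x. exp (dot d y (\<phi> x) - dot d y (mean \<gamma>)))"
    and exp2: "(\<integral>x. exp (dot d y (\<phi> x) - dot d y (mean \<gamma>)) \<partial>P \<gamma>) \<le> 2"
    and fourth: "(\<integral>x. (dot d y (\<phi> x) - dot d y (mean \<gamma>))^4 \<partial>P \<gamma>) \<le> var_dot \<gamma> y"
  shows "var_dot \<gamma> y / 4 \<le> jeffreys \<gamma> (\<lambda>i. \<gamma> i + y i)"
proof -
  let ?\<gamma> = "\<lambda>i. \<gamma> i + y i"
  interpret prob_space "P \<gamma>" by (rule prob_space_P) fact
  interpret P': prob_space "P ?\<gamma>" by (rule prob_space_P) fact
  define Z where "Z x = dot d y (\<phi> x) - dot d y (mean \<gamma>)" for x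
  have Z [measurable]: "Z \<in> borel_measurable \<nu>" unfolding Z_def[abs_def] by measurable
  \<comment> \<open>The tilted law has density \<open>w * exp (Z x)\<close> with respect to
    \<open>P \<gamma>\<close>, so \<open>w\<close> is the reciprocal of the mean of
    \<open>exp (Z x)\<close>.\<close>
  define w where "w = exp (dot d y (mean \<gamma>) - (C ?\<gamma> - C \<gamma>))"
  have w0: "w > 0" by (simp add: w_def)
  have ratio: "exp (dot d (\<lambda>i. ?\<gamma> i - \<gamma> i) (\<phi> x) - (C ?\<gamma> - C \<gamma>)) = w * exp (Z x)" for x
    by (simp add: w_def Z_def flip: exp_add)
  have intZ: "integrable (P \<theta>) (\<lambda>x. Z x ^ k)" if "\<theta> \<in> \<Gamma>" for k \<theta>
    using dot_power_integrable[OF that, of y "- dot d y (mean \<gamma>)"] by (simp add: Z_def)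
  have "1 = w * (\<integral>x. exp (Z x) \<partial>P \<gamma>)"
    using likelihood_ratio_integrable(2)[OF y, of \<gamma>] unfolding ratio by simp
  also have "\<dots> \<le> w * 2"
    using exp2 w0 by (intro mult_left_mono) (auto simp: Z_def)
  finally have w: "1 / 2 \<le> w" by simp
  have EZ: "(\<integral>x. Z x \<partial>P \<gamma>) = 0"
    unfolding Z_def[abs_def] using dot_integrable[OF \<gamma>]
    by (subst Bochner_Integration.integral_diff) (auto simp: expectation_dot[OF \<gamma>] \<gamma>)
  have intZ1: "integrable (P \<theta>) Z" if "\<theta> \<in> \<Gamma>" for \<theta>
    using intZ[OF that, of 1] by simp
  have intZe: "integrable (P \<gamma>) (\<lambda>x. exp (Z x) * Z x)"
  proof -
    have "integrable (P \<gamma>) (\<lambda>x. w * exp (Z x) * Z x)"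
      using intZ1[OF y] unfolding integrable_P_change[OF Z, of _ \<gamma>] ratio .
    then show ?thesis using w0 by (simp add: mult.assoc)
  qed
  have intA: "integrable (P \<gamma>) (\<lambda>x. Z x * (exp (Z x) - 1))"
  proof -
    have "integrable (P \<gamma>) (\<lambda>x. exp (Z x) * Z x - Z x)"
      using intZe intZ1[OF \<gamma>] by simp
    then show ?thesis by (simp add: algebra_simps)
  qed
  have "jeffreys \<gamma> ?\<gamma> = integral\<^sup>L (P ?\<gamma>) Z"
  proof -
    have "integral\<^sup>L (P ?\<gamma>) Z = dot d y (mean ?\<gamma>) - dot d y (mean \<gamma>)"
      unfolding Z_def[abs_def] using dot_integrable[OF y]
      by (subst Bochner_Integration.integral_diff) (auto simp: expectation_dot[OF y] y)
    then show ?thesis by (simp add: jeffreys_def dot_diff)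
  qed
  also have "\<dots> = (\<integral>x. w * exp (Z x) * Z x \<partial>P \<gamma>)"
    unfolding integral_P_change[OF Z, of _ \<gamma>] ratio ..
  also have "\<dots> = w * (\<integral>x. exp (Z x) * Z x \<partial>P \<gamma>)"
    by (simp add: mult.assoc)
  \<comment> \<open>Subtracting the vanishing mean of \<open>Z\<close> brings the integrand into the
    form of the polynomial minorant.\<close>
  also have "(\<integral>x. exp (Z x) * Z x \<partial>P \<gamma>) = (\<integral>x. Z x * (exp (Z x) - 1) \<partial>P \<gamma>)"
    using intZe intZ1[OF \<gamma>] EZ by (simp add: algebra_simps)
  finally have jeffreys: "jeffreys \<gamma> ?\<gamma> = w * (\<integral>x. Z x * (exp (Z x) - 1) \<partial>P \<gamma>)" .
  have "(\<integral>x. 3 / 4 * (Z x)\<^sup>2 - Z x ^ 4 / 4 \<partial>P \<gamma>) \<le> (\<integral>x. Z x * (exp (Z x) - 1) \<partial>P \<gamma>)"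
    using intZ[OF \<gamma>] intA by (intro integral_mono mult_exp_minus_one_ge) auto
  also have "(\<integral>x. 3 / 4 * (Z x)\<^sup>2 - Z x ^ 4 / 4 \<partial>P \<gamma>) = 3 / 4 * (\<integral>x. (Z x)\<^sup>2 \<partial>P \<gamma>) - (\<integral>x. Z x ^ 4 \<partial>P \<gamma>) / 4"
    using intZ[OF \<gamma>] by simp
  finally have "var_dot \<gamma> y / 2 \<le> (\<integral>x. Z x * (exp (Z x) - 1) \<partial>P \<gamma>)"
    using fourth by (simp add: var_dot_eq[OF \<gamma>] Z_def)
  then have "1 / 2 * (var_dot \<gamma> y / 2) \<le> w * (\<integral>x. Z x * (exp (Z x) - 1) \<partial>P \<gamma>)"
    using w var_dot_nonneg[of \<gamma> y] by (intro mult_mono) auto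
  then show ?thesis by (simp add: jeffreys)
qed

lemma jeffreys_ge_local:
  assumes \<gamma>: "\<gamma> \<in> \<Gamma>"
  shows "\<exists>\<rho>>0. \<forall>y\<in>Rd d. sd \<gamma> y \<le> \<rho> \<longrightarrow>
    (\<lambda>i. \<gamma> i + y i) \<in> \<Gamma> \<and> var_dot \<gamma> y / 4 \<le> jeffreys \<gamma> (\<lambda>i. \<gamma> i + y i)"
proof -
  interpret prob_space "P \<gamma>" by (rule prob_space_P) fact
  define A where "A = (\<Sum>i<d. \<bar>mean \<gamma> i\<bar>)"
  have A: "0 \<le> A" by (auto simp: A_def sum_nonneg)
  have n: "0 \<le> norm1 x" for x by (auto simp: norm1_def sum_nonneg)
  obtain c where c: "c > 0" "\<And>y k. y \<in> Rd d \<Longrightarrow> k < d \<Longrightarrow> c * \<bar>y k\<bar> \<le> sd \<gamma> y"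
    using coordinate_le_sd[OF \<gamma>] by blast
  obtain R where R: "R > 0" "\<And>y. y \<in> Rd d \<Longrightarrow> (\<forall>i<d. \<bar>y i\<bar> \<le> R) \<Longrightarrow> (\<lambda>i. \<gamma> i + y i) \<in> \<Gamma>"
    using openin_Euclidean_space_contains_box[OF open_params \<gamma>] by blast
  obtain r where r: "r > 0" "integrable (P \<gamma>) (\<lambda>x. exp (r * (A + norm1 x)))"
    "(\<integral>x. exp (r * (A + norm1 x)) \<partial>P \<gamma>) \<le> 2"
    using exp_small_moment[OF \<gamma>] by blast
  define K where "K = (\<integral>x. (A + norm1 x)^4 \<partial>P \<gamma>)"
  have K0: "K \<ge> 0" by (simp add: K_def)
  have intN: "integrable (P \<gamma>) (\<lambda>x. (A + norm1 x)^4)"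
    using A n by (intro polynomial_growth_integrable[OF \<gamma>, of _ 1 A 4]) (auto simp: power_abs)
  \<comment> \<open>The first entry keeps every \<open>\<bar>y i\<bar>\<close> below
    \<open>R\<close> and \<open>r\<close>, for membership in \<open>\<Gamma>\<close> and for the
    exponential moment. The second makes the fourth moment, at most \<open>q^4 * K\<close>, no
    larger than the variance; \<open>1 + K\<close> avoids a division by zero.\<close>
  define \<rho> where "\<rho> = min (c * min R r) (sqrt (c^4 / (1 + K)))"
  have "\<rho> > 0" using c(1) R(1) r(1) K0 by (simp add: \<rho>_def)
  moreover have "(\<lambda>i. \<gamma> i + y i) \<in> \<Gamma> \<and> var_dot \<gamma> y / 4 \<le> jeffreys \<gamma> (\<lambda>i. \<gamma> i + y i)"
    if y: "y \<in> Rd d" and small: "sd \<gamma> y \<le> \<rho>" for y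
  proof -
    define q where "q = sd \<gamma> y / c"
    have yq: "\<bar>y i\<bar> \<le> q" if "i < d" for i
      using c(2)[OF y that] c(1) by (simp add: q_def field_simps)
    have q0: "0 \<le> q" using c(1) var_dot_nonneg by (simp add: q_def)
    have "q * c \<le> c * min R r" using small c(1) by (simp add: q_def \<rho>_def)
    then have q: "q \<le> R" "q \<le> r" using c(1) by (auto simp: mult.commute[of q])
    have in_\<Gamma>: "(\<lambda>i. \<gamma> i + y i) \<in> \<Gamma>"
      using yq q by (intro R(2) y) fastforce
    define Z where "Z x = dot d y (\<phi> x) - dot d y (mean \<gamma>)" for x
    have Zq: "\<bar>Z x\<bar> \<le> q * (A + norm1 x)" for x
      unfolding Z_def A_def using yq by (rule abs_centered_dot_le)
    have expZ: "exp (Z x) \<le> exp (r * (A + norm1 x))" for x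
    proof -
      have "q * (A + norm1 x) \<le> r * (A + norm1 x)" using q A n[of x] by (intro mult_right_mono) auto
      then show ?thesis using Zq[of x] by simp
    qed
    have intE: "integrable (P \<gamma>) (\<lambda>x. exp (Z x))"
      by (rule Bochner_Integration.integrable_bound[OF r(2)]) (use expZ in \<open>auto simp: Z_def simp del: exp_le_cancel_iff\<close>)
    have E2: "(\<integral>x. exp (Z x) \<partial>P \<gamma>) \<le> 2"
      using integral_mono[OF intE r(2)] expZ r(3) by fastforce
    have "(\<integral>x. Z x ^ 4 \<partial>P \<gamma>) \<le> (\<integral>x. q^4 * (A + norm1 x)^4 \<partial>P \<gamma>)"
    proof (rule integral_mono)
      show "integrable (P \<gamma>) (\<lambda>x. Z x ^ 4)"
        using dot_power_integrable[OF \<gamma>, of y "- dot d y (mean \<gamma>)"] by (simp add: Z_def)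
      show "Z x ^ 4 \<le> q^4 * (A + norm1 x)^4" for x
        using power_mono[OF Zq[of x], of 4] by (simp add: power_mult_distrib)
    qed (use intN in simp)
    also have "\<dots> = q^4 * K" by (simp add: K_def)
    also have "\<dots> \<le> var_dot \<gamma> y"
    proof -
      have "(sd \<gamma> y)\<^sup>2 \<le> (sqrt (c^4 / (1 + K)))\<^sup>2"
        using small var_dot_nonneg[of \<gamma> y] by (intro power_mono) (auto simp: \<rho>_def)
      then have v: "var_dot \<gamma> y \<le> c^4 / (1 + K)"
        using var_dot_nonneg[of \<gamma> y] K0 by simp
      have "(sd \<gamma> y)^4 = (var_dot \<gamma> y)\<^sup>2"
        using var_dot_nonneg[of \<gamma> y] by (simp add: power4_eq_xxxx power2_eq_square)
      then have "q^4 * K = (var_dot \<gamma> y * K / c^4) * var_dot \<gamma> y"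
        by (simp add: q_def power_divide power2_eq_square)
      also have "\<dots> \<le> 1 * var_dot \<gamma> y"
      proof (rule mult_right_mono)
        have "var_dot \<gamma> y * K \<le> c^4 / (1 + K) * (1 + K)"
          using v K0 var_dot_nonneg[of \<gamma> y] by (intro mult_mono) auto
        then show "var_dot \<gamma> y * K / c^4 \<le> 1" using c(1) K0 by simp
      qed (rule var_dot_nonneg)
      finally show ?thesis by simp
    qed
    finally have "(\<integral>x. Z x ^ 4 \<partial>P \<gamma>) \<le> var_dot \<gamma> y" .
    with jeffreys_ge_of_moments[OF \<gamma> in_\<Gamma>] in_\<Gamma> intE E2 show ?thesis by (simp add: Z_def)
  qed
  ultimately show ?thesis by blast
qed

lemma var_dot_scale: "var_dot \<gamma> (\<lambda>i. u * a i) = u\<^sup>2 * var_dot \<gamma> a" if "\<gamma> \<in> \<Gamma>"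
  unfolding var_dot_eq[OF that] dot_scale right_diff_distrib[symmetric] power_mult_distrib by simp

text \<open>
  The linear growth beyond the radius \<open>\<rho>\<close> forces \<open>\<gamma>'\<close> to be close to \<open>\<gamma>\<close> as soon as the divergence is small
  compared with \<open>sd\<close>. It thereby replaces the continuity of the inverse of the mean map.
\<close>

lemma jeffreys_ge:
  assumes \<gamma>: "\<gamma> \<in> \<Gamma>"
  shows "\<exists>\<rho>>0. \<forall>\<gamma>'\<in>\<Gamma>.
    (let s = sd \<gamma> (\<lambda>i. \<gamma>' i - \<gamma> i) in s\<^sup>2 \<le> 4 * jeffreys \<gamma> \<gamma>' \<or> \<rho> < s \<and> \<rho> * s \<le> 4 * jeffreys \<gamma> \<gamma>')"
proof -
  obtain \<rho> where \<rho>: "\<rho> > 0" "\<And>y. y \<in> Rd d \<Longrightarrow> sd \<gamma> y \<le> \<rho> \<Longrightarrow>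
    (\<lambda>i. \<gamma> i + y i) \<in> \<Gamma> \<and> var_dot \<gamma> y / 4 \<le> jeffreys \<gamma> (\<lambda>i. \<gamma> i + y i)"
    using jeffreys_ge_local[OF \<gamma>] by blast
  have "let s = sd \<gamma> (\<lambda>i. \<gamma>' i - \<gamma> i) in s\<^sup>2 \<le> 4 * jeffreys \<gamma> \<gamma>' \<or> \<rho> < s \<and> \<rho> * s \<le> 4 * jeffreys \<gamma> \<gamma>'"
    if \<gamma>': "\<gamma>' \<in> \<Gamma>" for \<gamma>'
  proof -
    define y where "y = (\<lambda>i. \<gamma>' i - \<gamma> i)"
    define s where "s = sd \<gamma> y"
    have y: "y \<in> Rd d" using params_subset[OF \<gamma>] params_subset[OF \<gamma>'] by (simp add: in_Rd_iff y_def)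
    have "s\<^sup>2 \<le> 4 * jeffreys \<gamma> \<gamma>' \<or> \<rho> < s \<and> \<rho> * s \<le> 4 * jeffreys \<gamma> \<gamma>'"
    proof (cases "s \<le> \<rho>")
      case True
      then have "var_dot \<gamma> y / 4 \<le> jeffreys \<gamma> \<gamma>'"
        using \<rho>(2)[OF y] by (simp add: s_def y_def)
      then show ?thesis using var_dot_nonneg[of \<gamma> y] by (simp add: s_def)
    next
      case False
      \<comment> \<open>The point \<open>\<eta>\<close> lies on the segment from
        \<open>\<gamma>\<close> to \<open>\<gamma>'\<close> at \<open>sd\<close>-distance exactly
        \<open>\<rho>\<close>. The local bound covers the part up to \<open>\<eta>\<close>, and
        monotonicity of the mean map the rest.\<close>
      define u where "u = \<rho> / s"
      have u: "0 < u" "u < 1" using False \<rho>(1) by (auto simp: u_def field_simps)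
      define \<eta> where "\<eta> = (\<lambda>i. \<gamma> i + u * y i)"
      have "sd \<gamma> (\<lambda>i. u * y i) = u * s"
        using u by (simp add: var_dot_scale[OF \<gamma>] s_def real_sqrt_mult)
      also have "\<dots> = \<rho>" using False \<rho>(1) by (simp add: u_def)
      finally have sdu: "sd \<gamma> (\<lambda>i. u * y i) = \<rho>" .
      with \<rho>(2)[of "\<lambda>i. u * y i"] y have \<eta>: "\<eta> \<in> \<Gamma>" "var_dot \<gamma> (\<lambda>i. u * y i) / 4 \<le> jeffreys \<gamma> \<eta>"
        by (auto simp: in_Rd_iff \<eta>_def)
      have "var_dot \<gamma> (\<lambda>i. u * y i) = \<rho>\<^sup>2"
        using sdu var_dot_nonneg[of \<gamma> "\<lambda>i. u * y i"] by (metis real_sqrt_pow2)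
      then have 1: "\<rho>\<^sup>2 / 4 \<le> u * dot d y (\<lambda>i. mean \<eta> i - mean \<gamma> i)"
        using \<eta>(2) by (simp add: jeffreys_def \<eta>_def dot_scale)
      have "0 \<le> (1 - u) * dot d y (\<lambda>i. mean \<gamma>' i - mean \<eta> i)"
      proof -
        have "(\<lambda>i. \<gamma>' i - \<eta> i) = (\<lambda>i. (1 - u) * y i)"
          by (auto simp: \<eta>_def y_def algebra_simps)
        then show ?thesis using jeffreys_nonneg[OF \<eta>(1) \<gamma>'] by (simp add: jeffreys_def dot_scale)
      qed
      then have 2: "0 \<le> dot d y (\<lambda>i. mean \<gamma>' i - mean \<eta> i)"
        using u by (simp add: zero_le_mult_iff)
      have "jeffreys \<gamma> \<gamma>' = dot d y (\<lambda>i. mean \<gamma>' i - mean \<eta> i) + dot d y (\<lambda>i. mean \<eta> i - mean \<gamma> i)"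
        by (simp add: jeffreys_def y_def[symmetric] dot_diff)
      with 2 have "u * dot d y (\<lambda>i. mean \<eta> i - mean \<gamma> i) \<le> u * jeffreys \<gamma> \<gamma>'"
        using u by simp
      with 1 have "\<rho>\<^sup>2 / 4 \<le> u * jeffreys \<gamma> \<gamma>'" by linarith
      then have "\<rho>\<^sup>2 / 4 \<le> \<rho> / s * jeffreys \<gamma> \<gamma>'" by (simp add: u_def)
      then have "\<rho> * s \<le> 4 * jeffreys \<gamma> \<gamma>'"
        using \<rho>(1) False by (simp add: field_simps power2_eq_square)
      then show ?thesis using False by simp
    qed
    then show ?thesis by (simp add: s_def y_def Let_def)
  qed
  with \<rho>(1) show ?thesis by blast
qed

section \<open>Minimax bounds\<close>

abbreviation mean_inverse where "mean_inverse \<equiv> mean_inv d \<nu> \<phi> \<Gamma>"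

lemma mean_inverse:
  assumes "\<mu> \<in> mean ` \<Gamma>"
  shows "mean_inverse \<mu> \<in> \<Gamma>" "mean (mean_inverse \<mu>) = \<mu>"
  using assms by (auto simp: mean_inv_def inv_into_into f_inv_into_f)

lemma sd_minus: "\<gamma> \<in> \<Gamma> \<Longrightarrow> sd \<gamma> (\<lambda>i. - a i) = sd \<gamma> a"
  using var_dot_scale[of \<gamma> "-1" a] by simp

text \<open>If \<^term>\<open>sd \<gamma> a\<close> vanishes, then so does the vector \<open>v\<close> of the proof, by division by zero.\<close>

lemma sd_support:
  assumes "\<gamma> \<in> \<Gamma>"
  shows "\<exists>v. dot d a v = sd \<gamma> a \<and> (\<forall>b. dot d b v \<le> sd \<gamma> b)"
proof -
  \<comment> \<open>This is the gradient of \<open>sd \<gamma>\<close> at \<open>a\<close>; the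
    bound for other \<open>b\<close> is the Cauchy-Schwarz inequality for covariances.\<close>
  define v where "v = (\<lambda>i. (1 / sd \<gamma> a) * cov_dot \<gamma> (\<lambda>j. if j = i then 1 else 0) a)"
  have v: "dot d b v = cov_dot \<gamma> b a / sd \<gamma> a" for b
    unfolding v_def dot_scale cov_dot_expand[OF assms, symmetric] by simp
  have "dot d b v \<le> sd \<gamma> b" for b
    using cov_dot_le[OF assms, of b a] var_dot_nonneg[of \<gamma> a] var_dot_nonneg[of \<gamma> b]
    by (cases "sd \<gamma> a = 0") (auto simp: v field_simps)
  moreover have "dot d a v = sd \<gamma> a"
    using var_dot_nonneg[of \<gamma> a] by (simp add: v cov_dot_self[OF assms] real_div_sqrt)
  ultimately show ?thesis by blast
qed

text \<open>The segment is run through at unit speed in the mean parameter, with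
  \<open>s = 0\<close> at its midpoint, and only \<open>\<bar>s\<bar> \<le> 1 / 16\<close> is kept.
  There \<open>\<delta>\<close> has norm at most \<open>K\<close> in the norm dual to
  \<open>sd (g s)\<close>, so the Fisher information along \<open>\<delta>\<close> is bounded, and
  with it the divergence between the two ends.\<close>

lemma hellinger_close_pair:
  assumes M0: "M0 \<subseteq> mean ` \<Gamma>"
    and conc: "\<And>a. a \<in> Rd d \<Longrightarrow> seq_concave_on M0 (\<lambda>\<mu>. sd (mean_inverse \<mu>) a)"
    and \<mu>: "\<mu> \<in> M0" "\<mu>' \<in> M0" and t: "t > 0"
    and le: "\<And>a. a \<in> Rd d \<Longrightarrow>
      dot d a (\<lambda>i. \<mu> i - \<mu>' i) \<le> t * (sd (mean_inverse \<mu>) a + sd (mean_inverse \<mu>') a)"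
  shows "\<exists>\<theta>\<in>mean_inverse ` M0. \<exists>\<theta>'\<in>mean_inverse ` M0.
    hellinger \<nu> (ef_density d \<nu> \<phi> \<theta>) (ef_density d \<nu> \<phi> \<theta>') \<le> t \<and>
    dot d h (mean \<theta>) - dot d h (mean \<theta>') = dot d h (\<lambda>i. \<mu> i - \<mu>' i) / 8"
proof -
  define \<delta> where "\<delta> = (\<lambda>i. \<mu> i - \<mu>' i)"
  define pt where "pt s = (\<lambda>i. (1 / 2 + s) * \<mu> i + (1 / 2 - s) * \<mu>' i)" for s
  \<comment> \<open>Both weights \<open>1 / 2 + s\<close> and \<open>1 / 2 - s\<close> are at least
    \<open>7 / 16\<close> on the interval.\<close>
  define K where "K = 16 / 7 * t"
  have K: "K > 0" using t by (simp add: K_def)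
  let ?I = "{-1/16..1/16::real}"
  have conc0: "(1 / 2 + s) * sd (mean_inverse \<mu>) a + (1 / 2 - s) * sd (mean_inverse \<mu>') a
      \<le> sd (mean_inverse (pt s)) a" and pt: "pt s \<in> M0" if "s \<in> ?I" "a \<in> Rd d" for s a
    using conc[OF that(2)] \<mu> that(1) by (auto simp: seq_concave_on_def seq_convex_def pt_def)
  have pt: "pt s \<in> M0" if "s \<in> ?I" for s
    using pt[OF that, of "\<lambda>_. 0"] by (simp add: in_Rd_iff)
  define g where "g s = mean_inverse (pt s)" for s
  have g: "g s \<in> \<Gamma>" "mean (g s) = pt s" if "s \<in> ?I" for s
    using mean_inverse[of "pt s"] pt[OF that] M0 by (auto simp: g_def)
  have dual: "dot d a \<delta> \<le> K * sd (g s) a" if s: "s \<in> ?I" and a: "a \<in> Rd d" for s a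
  proof -
    let ?x = "sd (mean_inverse \<mu>) a" and ?y = "sd (mean_inverse \<mu>') a"
    have "7 / 16 * ?x + 7 / 16 * ?y \<le> (1 / 2 + s) * ?x + (1 / 2 - s) * ?y"
      using s var_dot_nonneg by (intro add_mono mult_right_mono) auto
    also have "\<dots> \<le> sd (g s) a" using conc0[OF s a] by (simp add: g_def)
    finally have "t * (7 / 16 * (?x + ?y)) \<le> t * sd (g s) a"
      using t by (intro mult_left_mono) auto
    then show ?thesis using le[OF a] by (simp add: K_def \<delta>_def distrib_left)
  qed
  have abs_dual: "\<bar>dot d a \<delta>\<bar> \<le> K * sd (g s) a" if s: "s \<in> ?I" and a: "a \<in> Rd d" for s a
    using dual[OF s a] dual[OF s, of "\<lambda>i. - a i"] a g[OF s] by (simp add: in_Rd_iff dot_minus sd_minus abs_le_iff)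
  \<comment> \<open>Mean parameters on the segment differ by multiples of \<open>\<delta>\<close>,
    so the divergence between two of its points is the increment of \<open>s\<close> times the
    increment of \<open>j\<close>.\<close>
  define j where "j s = dot d (g s) \<delta>" for s
  have jeffreys_eq: "jeffreys (g s) (g s') = (s' - s) * (j s' - j s)" if "s \<in> ?I" "s' \<in> ?I" for s s'
  proof -
    have "(\<lambda>i. mean (g s') i - mean (g s) i) = (\<lambda>i. (s' - s) * \<delta> i)"
      using that by (auto simp: g pt_def \<delta>_def algebra_simps)
    then show ?thesis by (simp add: jeffreys_def dot_scale j_def dot_diff)
  qed
  have jeffreys_sym: "jeffreys (g s) (g s') = jeffreys (g s') (g s)" if "s \<in> ?I" "s' \<in> ?I" for s s'
    unfolding jeffreys_eq[OF that] jeffreys_eq[OF that(2,1)] by (simp add: algebra_simps)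
  \<comment> \<open>Locally \<open>sd\<^sup>2 / 4 \<le> jeffreys \<le> \<bar>s' - s\<bar> * K * sd\<close>, so that \<open>j\<close> has Lipschitz constant \<open>4 * K\<^sup>2\<close>.\<close>
  have "\<bar>j (1/16) - j (- 1/16)\<bar> \<le> 4 * K\<^sup>2 * (1/16 - (- 1/16))"
  proof (rule pointwise_lipschitz_imp_lipschitz)
    fix s :: real assume "- 1/16 \<le> s" "s \<le> 1/16"
    then have s: "s \<in> ?I" by simp
    obtain \<rho> where \<rho>: "\<rho> > 0" "\<And>\<gamma>'. \<gamma>' \<in> \<Gamma> \<Longrightarrow>
      let x = sd (g s) (\<lambda>i. \<gamma>' i - g s i) in x\<^sup>2 \<le> 4 * jeffreys (g s) \<gamma>' \<or> \<rho> < x \<and> \<rho> * x \<le> 4 * jeffreys (g s) \<gamma>'"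
      using jeffreys_ge[OF g(1)[OF s]] by blast
    show "\<exists>r>0. \<forall>s'. - 1/16 \<le> s' \<and> s' \<le> 1/16 \<and> \<bar>s' - s\<bar> < r \<longrightarrow> \<bar>j s' - j s\<bar> \<le> 4 * K\<^sup>2 * \<bar>s' - s\<bar>"
    \<comment> \<open>Within this radius \<open>4 * K * \<bar>s' - s\<bar> < \<rho>\<close>, which
      excludes the alternative of linear growth in \<open>jeffreys_ge\<close>.\<close>
    proof (intro exI[of _ "\<rho> / (4 * K)"] conjI allI impI)
      fix s' assume "- 1/16 \<le> s' \<and> s' \<le> 1/16 \<and> \<bar>s' - s\<bar> < \<rho> / (4 * K)"
      then have s': "s' \<in> ?I" and near: "4 * K * \<bar>s' - s\<bar> < \<rho>"
        using K by (auto simp: field_simps)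
      define y where "y = (\<lambda>i. g s' i - g s i)"
      define x where "x = sd (g s) y"
      have y: "y \<in> Rd d" using params_subset[OF g(1)[OF s]] params_subset[OF g(1)[OF s']] by (simp add: in_Rd_iff y_def)
      have x0: "x \<ge> 0" using var_dot_nonneg by (simp add: x_def)
      have jx: "\<bar>j s' - j s\<bar> \<le> K * x"
        using abs_dual[OF s y] by (simp add: j_def y_def x_def dot_diff)
      have "jeffreys (g s) (g s') \<le> \<bar>s' - s\<bar> * \<bar>j s' - j s\<bar>"
        unfolding jeffreys_eq[OF s s'] abs_mult[symmetric] by (rule abs_ge_self)
      also have "\<dots> \<le> \<bar>s' - s\<bar> * (K * x)" using jx by (intro mult_left_mono) auto
      finally have Jx: "4 * jeffreys (g s) (g s') \<le> (4 * K * \<bar>s' - s\<bar>) * x" by (simp add: mult_ac)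
      have "x \<le> 4 * K * \<bar>s' - s\<bar>"
      proof (rule ccontr)
        assume *: "\<not> ?thesis"
        then have "x > 0" using K by (smt (verit) zero_le_mult_iff abs_ge_zero)
        have "x\<^sup>2 \<le> 4 * jeffreys (g s) (g s') \<or> \<rho> < x \<and> \<rho> * x \<le> 4 * jeffreys (g s) (g s')"
          using \<rho>(2)[OF g(1)[OF s']] by (simp add: Let_def x_def y_def)
        then show False
        proof
          assume "x\<^sup>2 \<le> 4 * jeffreys (g s) (g s')"
          with Jx have "x * x \<le> (4 * K * \<bar>s' - s\<bar>) * x" by (simp add: power2_eq_square)
          with \<open>x > 0\<close> * show False by (simp add: mult_le_cancel_right)
        next
          assume "\<rho> < x \<and> \<rho> * x \<le> 4 * jeffreys (g s) (g s')"
          with Jx have "\<rho> * x \<le> (4 * K * \<bar>s' - s\<bar>) * x" by linarith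
          with \<open>x > 0\<close> near show False by (simp add: mult_le_cancel_right)
        qed
      qed
      then have "K * x \<le> K * (4 * K * \<bar>s' - s\<bar>)" using K by (intro mult_left_mono) auto
      with jx show "\<bar>j s' - j s\<bar> \<le> 4 * K\<^sup>2 * \<bar>s' - s\<bar>" by (simp add: power2_eq_square algebra_simps)
    qed (use \<rho>(1) K in auto)
  qed auto
  \<comment> \<open>The increment of \<open>s\<close> is \<open>1 / 8\<close> and that of
    \<open>j\<close> at most \<open>4 * K^2 / 8\<close>; the product \<open>K^2 / 16\<close> equals
    \<open>16 / 49 * t^2\<close>.\<close>
  then have "jeffreys (g (- 1/16)) (g (1/16)) \<le> K\<^sup>2 / 16"
    using abs_ge_self[of "j (1/16) - j (- 1/16)"] by (subst jeffreys_eq) auto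
  also have "\<dots> \<le> t\<^sup>2" using t by (simp add: K_def power2_eq_square)
  finally have Jt: "jeffreys (g (- 1/16)) (g (1/16)) \<le> t\<^sup>2" .
  have "(hellinger \<nu> (ef_density d \<nu> \<phi> (g (1/16))) (ef_density d \<nu> \<phi> (g (- 1/16))))\<^sup>2 \<le> jeffreys (g (1/16)) (g (- 1/16))"
    by (intro hellinger_square_le_jeffreys g) auto
  also have "jeffreys (g (1/16)) (g (- 1/16)) = jeffreys (g (- 1/16)) (g (1/16))"
    by (rule jeffreys_sym) auto
  finally have "(hellinger \<nu> (ef_density d \<nu> \<phi> (g (1/16))) (ef_density d \<nu> \<phi> (g (- 1/16))))\<^sup>2 \<le> t\<^sup>2"
    using Jt by linarith
  then have H: "hellinger \<nu> (ef_density d \<nu> \<phi> (g (1/16))) (ef_density d \<nu> \<phi> (g (- 1/16))) \<le> t"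
    by (rule power2_le_imp_le) (use t in simp)
  have "dot d h (mean (g (1/16))) - dot d h (mean (g (- 1/16)))
      = dot d h (\<lambda>i. mean (g (1/16)) i - mean (g (- 1/16)) i)"
    by (simp only: dot_diff)
  also have "(\<lambda>i. mean (g (1/16)) i - mean (g (- 1/16)) i) = (\<lambda>i. 1 / 8 * (\<mu> i - \<mu>' i))"
    by (auto simp: g pt_def algebra_simps)
  also have "dot d h \<dots> = dot d h (\<lambda>i. \<mu> i - \<mu>' i) / 8"
    by (simp only: dot_scale)
  finally have T: "dot d h (mean (g (1/16))) - dot d h (mean (g (- 1/16))) = dot d h (\<lambda>i. \<mu> i - \<mu>' i) / 8" .
  have "g s \<in> mean_inverse ` M0" if "s \<in> ?I" for s
    unfolding g_def using pt[OF that] by (rule imageI)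
  then have "g (1/16) \<in> mean_inverse ` M0" "g (- 1/16) \<in> mean_inverse ` M0" by simp_all
  with H T show ?thesis by blast
qed

text \<open>Convex duality by separation. A point of \<open>S\<close> pairs a slack vector with the
  gain \<open>\<langle>h, \<mu> - \<mu>'\<rangle>\<close>. At zero slack
  \<open>hellinger_close_pair\<close> limits the gain to \<open>8 * W\<close>; the supergradient
  prices nonzero slack, and its negative is the coefficient vector of the estimator.\<close>

lemma optimal_affine_functional:
  assumes M0: "M0 \<subseteq> mean ` \<Gamma>" "M0 \<noteq> {}"
    and conc: "\<And>a. a \<in> Rd d \<Longrightarrow> seq_concave_on M0 (\<lambda>\<mu>. sd (mean_inverse \<mu>) a)"
    and t: "t > 0"
    and modulus: "\<And>\<theta> \<theta>'. \<theta> \<in> mean_inverse ` M0 \<Longrightarrow> \<theta>' \<in> mean_inverse ` M0 \<Longrightarrow>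
      hellinger \<nu> (ef_density d \<nu> \<phi> \<theta>) (ef_density d \<nu> \<phi> \<theta>') \<le> t \<Longrightarrow>
      dot d h (mean \<theta>) - dot d h (mean \<theta>') \<le> W"
  shows "\<exists>a\<in>Rd d. \<exists>b. \<forall>\<mu>\<in>M0. \<bar>dot d a \<mu> + b - dot d h \<mu>\<bar> + t * sd (mean_inverse \<mu>) a \<le> 4 * W"
proof -
  let ?sd = "\<lambda>\<mu>. sd (mean_inverse \<mu>)"
  \<comment> \<open>Up to coordinates from \<open>d\<close> on, \<open>v\<close> ranges over the
    Minkowski sum of the covariance ellipsoids at \<open>\<mu>\<close> and
    \<open>\<mu>'\<close>.\<close>
  define S where "S = {(\<lambda>i. t * v i - (\<mu> i - \<mu>' i), dot d h (\<lambda>i. \<mu> i - \<mu>' i)) |\<mu> \<mu>' v.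
    \<mu> \<in> M0 \<and> \<mu>' \<in> M0 \<and> (\<forall>a\<in>Rd d. dot d a v \<le> ?sd \<mu> a + ?sd \<mu>' a)}"
  have inv: "mean_inverse \<mu> \<in> \<Gamma>" if "\<mu> \<in> M0" for \<mu>
    using mean_inverse(1) M0(1) that by blast
  obtain \<mu>0 where \<mu>0: "\<mu>0 \<in> M0" using M0(2) by auto
  obtain c where c: "c > 0" "\<And>a k. a \<in> Rd d \<Longrightarrow> k < d \<Longrightarrow> c * \<bar>a k\<bar> \<le> ?sd \<mu>0 a"
    using coordinate_le_sd[OF inv[OF \<mu>0]] by blast
  \<comment> \<open>Taking \<open>\<mu> = \<mu>' = \<mu>0\<close> leaves only \<open>t * v\<close>,
    and the ellipsoid contains a short vector in both directions of every axis.\<close>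
  have unit: "((\<lambda>i. if i = k then t * r else 0), 0) \<in> S" if "k < d" "\<bar>r\<bar> \<le> c" for k r
  proof -
    have "dot d a (\<lambda>i. if i = k then r else 0) \<le> ?sd \<mu>0 a + ?sd \<mu>0 a" if a: "a \<in> Rd d" for a
    proof -
      have "dot d a (\<lambda>i. if i = k then r else 0) = a k * r" using \<open>k < d\<close> by (simp add: dot_unit)
      also have "\<dots> \<le> \<bar>a k\<bar> * c"
        using abs_ge_self[of "a k * r"] mult_left_mono[OF \<open>\<bar>r\<bar> \<le> c\<close>, of "\<bar>a k\<bar>"] by (simp add: abs_mult)
      also have "\<dots> \<le> ?sd \<mu>0 a" using c(2)[OF a \<open>k < d\<close>] by (simp add: mult.commute)
      finally show ?thesis using real_sqrt_ge_zero[OF var_dot_nonneg, of "mean_inverse \<mu>0" a] by linarith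
    qed
    then show ?thesis
      unfolding S_def using \<mu>0
      by (intro CollectI exI[of _ \<mu>0] exI[of _ "\<lambda>i. if i = k then r else 0"]) auto
  qed
  have "\<exists>a\<in>Rd d. \<forall>(x, y)\<in>S. y \<le> 8 * W + dot d a x"
  proof (rule supergradient_exists)
    fix x y x' y' and u v :: real
    assume "(x, y) \<in> S" "(x', y') \<in> S" and uv: "0 \<le> u" "0 \<le> v" "u + v = 1"
    then obtain m1 m2 w m1' m2' w' where
      1: "x = (\<lambda>i. t * w i - (m1 i - m2 i))" "y = dot d h (\<lambda>i. m1 i - m2 i)" "m1 \<in> M0" "m2 \<in> M0"
        "\<And>a. a \<in> Rd d \<Longrightarrow> dot d a w \<le> ?sd m1 a + ?sd m2 a" and
      2: "x' = (\<lambda>i. t * w' i - (m1' i - m2' i))" "y' = dot d h (\<lambda>i. m1' i - m2' i)" "m1' \<in> M0" "m2' \<in> M0"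
        "\<And>a. a \<in> Rd d \<Longrightarrow> dot d a w' \<le> ?sd m1' a + ?sd m2' a"
      unfolding S_def by blast
    let ?mix = "\<lambda>p q i. u * p i + v * q i"
    have mixM: "?mix p q \<in> M0" if "p \<in> M0" "q \<in> M0" for p q
      using conc[of "\<lambda>_. 0"] that uv by (auto simp: seq_concave_on_def seq_convex_def in_Rd_iff)
    have mixsd: "u * ?sd p a + v * ?sd q a \<le> ?sd (?mix p q) a" if "p \<in> M0" "q \<in> M0" "a \<in> Rd d" for p q a
      using conc[OF that(3)] that uv by (auto simp: seq_concave_on_def)
    \<comment> \<open>This is where concavity of the standard deviation enters: it makes
      \<open>S\<close> convex.\<close>
    have w: "dot d a (?mix w w') \<le> ?sd (?mix m1 m1') a + ?sd (?mix m2 m2') a" if a: "a \<in> Rd d" for a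
    proof -
      have "dot d a (?mix w w') = u * dot d a w + v * dot d a w'" by (simp add: dot_add dot_scale)
      also have "\<dots> \<le> u * (?sd m1 a + ?sd m2 a) + v * (?sd m1' a + ?sd m2' a)"
        using 1(5)[OF a] 2(5)[OF a] uv by (intro add_mono mult_left_mono) auto
      also have "\<dots> \<le> ?sd (?mix m1 m1') a + ?sd (?mix m2 m2') a"
        using mixsd[OF 1(3) 2(3) a] mixsd[OF 1(4) 2(4) a] by (simp add: algebra_simps)
      finally show ?thesis .
    qed
    have "?mix x x' = (\<lambda>i. t * ?mix w w' i - (?mix m1 m1' i - ?mix m2 m2' i))"
      by (auto simp: 1(1) 2(1) algebra_simps)
    moreover have "u * y + v * y' = dot d h (\<lambda>i. ?mix m1 m1' i - ?mix m2 m2' i)"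
      by (simp add: 1(2) 2(2) dot_diff dot_add dot_scale algebra_simps)
    ultimately show "(?mix x x', u * y + v * y') \<in> S"
      unfolding S_def using mixM[OF 1(3) 2(3)] mixM[OF 1(4) 2(4)] w
      by (intro CollectI exI[of _ "?mix m1 m1'"] exI[of _ "?mix m2 m2'"] exI[of _ "?mix w w'"]) simp
  next
    fix k assume k: "k < d"
    show "\<exists>r>0. \<exists>y. ((\<lambda>i. if i = k then r else 0), y) \<in> S"
      using unit[OF k, of c] c(1) t by (intro exI[of _ "t * c"]) auto
    show "\<exists>r<0. \<exists>y. ((\<lambda>i. if i = k then r else 0), y) \<in> S"
      using unit[OF k, of "- c"] c(1) t by (intro exI[of _ "t * - c"]) (auto simp: mult_neg_pos)
  next
    fix x y assume "(x, y) \<in> S" and x0: "\<forall>i<d. x i = 0"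
    then obtain \<mu> \<mu>' v where xy: "x = (\<lambda>i. t * v i - (\<mu> i - \<mu>' i))" "y = dot d h (\<lambda>i. \<mu> i - \<mu>' i)"
      "\<mu> \<in> M0" "\<mu>' \<in> M0" "\<And>a. a \<in> Rd d \<Longrightarrow> dot d a v \<le> ?sd \<mu> a + ?sd \<mu>' a"
      unfolding S_def by blast
    have "dot d a (\<lambda>i. \<mu> i - \<mu>' i) \<le> t * (?sd \<mu> a + ?sd \<mu>' a)" if a: "a \<in> Rd d" for a
    proof -
      have "dot d a (\<lambda>i. \<mu> i - \<mu>' i) = dot d a (\<lambda>i. t * v i)"
        unfolding dot_def using x0 by (intro sum.cong) (auto simp: xy(1))
      also have "\<dots> \<le> t * (?sd \<mu> a + ?sd \<mu>' a)"
        unfolding dot_scale using xy(5)[OF a] t by (intro mult_left_mono) auto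
      finally show ?thesis .
    qed
    from hellinger_close_pair[OF M0(1) conc xy(3,4) t this, of h] modulus
    show "y \<le> 8 * W" unfolding xy(2) by fastforce
  qed
  then obtain a0 where a0: "a0 \<in> Rd d" "\<And>x y. (x, y) \<in> S \<Longrightarrow> y \<le> 8 * W + dot d a0 x" by blast
  define a where "a = (\<lambda>i. - a0 i)"
  have a: "a \<in> Rd d" using a0(1) by (simp add: a_def in_Rd_iff)
  have a0a: "dot d a0 x = - dot d a x" for x by (simp add: a_def dot_minus)
  have "(dot d h \<mu> - dot d a \<mu> + t * ?sd \<mu> a) + (dot d a \<mu>' - dot d h \<mu>' + t * ?sd \<mu>' a) \<le> 8 * W"
    if \<mu>: "\<mu> \<in> M0" "\<mu>' \<in> M0" for \<mu> \<mu>'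
  proof -
    obtain v where v: "dot d a v = ?sd \<mu> a" "\<And>b. dot d b v \<le> ?sd \<mu> b"
      using sd_support[OF inv[OF \<mu>(1)]] by blast
    obtain v' where v': "dot d a v' = ?sd \<mu>' a" "\<And>b. dot d b v' \<le> ?sd \<mu>' b"
      using sd_support[OF inv[OF \<mu>(2)]] by blast
    \<comment> \<open>The support vectors attain both standard deviations in direction
      \<open>a\<close>, so the supergradient inequality at this point is the wanted bound.\<close>
    have "(\<lambda>i. t * (v i + v' i) - (\<mu> i - \<mu>' i), dot d h (\<lambda>i. \<mu> i - \<mu>' i)) \<in> S"
      unfolding S_def using \<mu> v(2) v'(2)
      by (intro CollectI exI[of _ \<mu>] exI[of _ \<mu>'] exI[of _ "\<lambda>i. v i + v' i"]) (auto simp: dot_add intro: add_mono)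
    from a0(2)[OF this] show ?thesis
      by (simp add: a0a dot_diff dot_scale dot_add v v' algebra_simps)
  qed
  \<comment> \<open>The bound for pairs splits into one for each sign of the bias, at the price of a
    common constant \<open>b\<close>.\<close>
  then obtain b where "\<forall>\<mu>\<in>M0. dot d h \<mu> - dot d a \<mu> + t * ?sd \<mu> a \<le> 8 * W / 2 + b \<and>
      dot d a \<mu> - dot d h \<mu> + t * ?sd \<mu> a \<le> 8 * W / 2 - b"
    using separate_additive_bound[of M0 "\<lambda>\<mu>. dot d h \<mu> - dot d a \<mu> + t * ?sd \<mu> a"
        "\<lambda>\<mu>. dot d a \<mu> - dot d h \<mu> + t * ?sd \<mu> a" "8 * W"] by blast
  then have "\<bar>dot d a \<mu> + b - dot d h \<mu>\<bar> + t * ?sd \<mu> a \<le> 4 * W" if "\<mu> \<in> M0" for \<mu>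
    using that by (auto simp: abs_if)
  then show ?thesis using a by blast
qed

section \<open>Risk of affine estimators and the two-point bound\<close>

lemma affine_estimator_risk:
  assumes \<gamma>: "\<gamma> \<in> \<Gamma>" and "1 \<le> n"
  shows "(\<integral>\<^sup>+X. ennreal (((1 / real n) * (\<Sum>i<n. dot d a (\<phi> (X i)) + b) - s)\<^sup>2) \<partial>(\<Pi>\<^sub>M i\<in>{..<n}. P \<gamma>))
    = ennreal ((dot d a (mean \<gamma>) + b - s)\<^sup>2 + var_dot \<gamma> a / n)"
proof -
  define Z where "Z x = dot d a (\<phi> x) - dot d a (mean \<gamma>)" for x
  have *: "(1 / real n) * (\<Sum>i<n. dot d a (\<phi> (X i)) + b) - s
      = (1 / real n) * (\<Sum>i<n. Z (X i)) + (dot d a (mean \<gamma>) + b - s)" for X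
    using \<open>1 \<le> n\<close> by (simp add: Z_def sum.distrib sum_subtractf field_simps)
  interpret prob_space "P \<gamma>" by (rule prob_space_P) fact
  have "integrable (P \<gamma>) Z"
    unfolding Z_def[abs_def] using dot_integrable[OF \<gamma>] by simp
  moreover have "integral\<^sup>L (P \<gamma>) Z = 0"
    unfolding Z_def[abs_def] using dot_integrable[OF \<gamma>] \<gamma>
    by (subst Bochner_Integration.integral_diff) (auto simp: expectation_dot)
  moreover have "integrable (P \<gamma>) (\<lambda>x. (Z x)\<^sup>2)"
    unfolding Z_def by (rule centered_square_integrable[OF \<gamma>])
  ultimately show ?thesis
    unfolding * using prob_space_P[OF \<gamma>] \<open>1 \<le> n\<close>
    by (subst iid_mean_square_error) (auto simp: var_dot_eq[OF \<gamma>] Z_def)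
qed

text \<open>With \<open>X\<close> the log-likelihood ratio, the product of the square roots of the
  densities is the first density times \<open>exp (X / 2)\<close>. The identity follows by expanding
  the square, both densities having integral 1.\<close>

lemma affinity_eq:
  assumes "\<gamma> \<in> \<Gamma>" "\<gamma>' \<in> \<Gamma>"
  defines "X \<equiv> \<lambda>x. dot d (\<lambda>i. \<gamma>' i - \<gamma> i) (\<phi> x) - (C \<gamma>' - C \<gamma>)"
  shows "integrable (P \<gamma>) (\<lambda>x. exp (X x / 2))"
    and "(\<integral>x. exp (X x / 2) \<partial>P \<gamma>) = 1 - (hellinger \<nu> (ef_density d \<nu> \<phi> \<gamma>) (ef_density d \<nu> \<phi> \<gamma>'))\<^sup>2 / 2"
proof -
  let ?p = "ef_density d \<nu> \<phi> \<gamma>" and ?q = "ef_density d \<nu> \<phi> \<gamma>'"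
  interpret prob_space "P \<gamma>" by (rule prob_space_P) fact
  have X [measurable]: "X \<in> borel_measurable \<nu>" unfolding X_def by measurable
  have eX: "integrable (P \<gamma>) (\<lambda>x. exp (X x))"
    unfolding X_def by (rule likelihood_ratio_integrable(1)[OF assms(2)])
  have half: "exp (y / 2) \<le> 1 + exp y" for y :: real
    by (cases "y \<le> 0") (auto intro: add_increasing add_increasing2)
  show i: "integrable (P \<gamma>) (\<lambda>x. exp (X x / 2))"
    by (rule Bochner_Integration.integrable_bound[of _ "\<lambda>x. 1 + exp (X x)"])
      (use eX in \<open>auto simp: half add_nonneg_nonneg\<close>)
  have dens: "integrable \<nu> (ef_density d \<nu> \<phi> \<theta>) \<and> integral\<^sup>L \<nu> (ef_density d \<nu> \<phi> \<theta>) = 1" if "\<theta> \<in> \<Gamma>" for \<theta>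
  proof -
    interpret T: prob_space "P \<theta>" by (rule prob_space_P) fact
    show ?thesis
      using integrable_P[of "\<lambda>_. 1" \<theta>] integral_P[of "\<lambda>_. 1" \<theta>] that by simp
  qed
  have pt: "(sqrt (?p x) - sqrt (?q x))\<^sup>2 = ?p x + ?q x - 2 * (?p x * exp (X x / 2))" for x
  proof -
    have "sqrt (?p x) * sqrt (?q x) = ?p x * exp (X x / 2)"
      by (simp add: ef_density_def sqrt_exp X_def dot_diff field_simps flip: exp_add)
    moreover have "(sqrt (?p x))\<^sup>2 = ?p x" "(sqrt (?q x))\<^sup>2 = ?q x" by (simp_all add: ef_density_def)
    ultimately show ?thesis by (simp add: power2_diff)
  qed
  have "(hellinger \<nu> ?p ?q)\<^sup>2 = (\<integral>x. (sqrt (?p x) - sqrt (?q x))\<^sup>2 \<partial>\<nu>)"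
    by (simp add: hellinger_def)
  also have "\<dots> = 2 - 2 * (\<integral>x. exp (X x / 2) \<partial>P \<gamma>)"
    unfolding pt using dens[OF assms(1)] dens[OF assms(2)] i
    by (simp add: integral_P integrable_P)
  finally show "(\<integral>x. exp (X x / 2) \<partial>P \<gamma>) = 1 - (hellinger \<nu> ?p ?q)\<^sup>2 / 2"
    by (simp add: field_simps)
qed

text \<open>The affinity of single observations is at least \<open>1 - 1 / (2 * n)\<close>, so
  Bernoulli's inequality bounds its \<open>n\<close>-th power below by \<open>1 / 2\<close>.\<close>

lemma quad_risk_lower_bound:
  fixes n :: nat
  assumes "\<gamma> \<in> \<Gamma>" "\<gamma>' \<in> \<Gamma>" "1 \<le> n" and f: "f \<in> borel_measurable (\<Pi>\<^sub>M i\<in>{..<n}. \<nu>)"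
    and H: "hellinger \<nu> (ef_density d \<nu> \<phi> \<gamma>) (ef_density d \<nu> \<phi> \<gamma>') \<le> 1 / sqrt n"
    and R: "0 \<le> R" "(\<integral>\<^sup>+X. ennreal ((f X - s)\<^sup>2) \<partial>(\<Pi>\<^sub>M i\<in>{..<n}. P \<gamma>)) \<le> ennreal R"
      "(\<integral>\<^sup>+X. ennreal ((f X - s')\<^sup>2) \<partial>(\<Pi>\<^sub>M i\<in>{..<n}. P \<gamma>')) \<le> ennreal R"
  shows "\<bar>s - s'\<bar> \<le> 4 * sqrt R"
proof -
  let ?H = "hellinger \<nu> (ef_density d \<nu> \<phi> \<gamma>) (ef_density d \<nu> \<phi> \<gamma>')"
  define X where "X x = dot d (\<lambda>i. \<gamma>' i - \<gamma> i) (\<phi> x) - (C \<gamma>' - C \<gamma>)" for x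
  define A where "A = (\<integral>x. exp (X x / 2) \<partial>P \<gamma>)"
  have aff: "integrable (P \<gamma>) (\<lambda>x. exp (X x / 2))" "A = 1 - ?H\<^sup>2 / 2"
    unfolding A_def X_def using affinity_eq[OF assms(1,2)] by auto
  have Q: "P \<gamma>' = density (P \<gamma>) (\<lambda>x. ennreal (exp (X x)))"
    unfolding X_def by (rule P_change)
  have X: "X \<in> borel_measurable \<nu>" unfolding X_def[abs_def] by measurable
  have le: "\<bar>s - s'\<bar> * A ^ n \<le> 2 * sqrt R"
    unfolding A_def sqrt_exp[symmetric]
  proof (rule two_point_lower_bound)
    show "f \<in> borel_measurable (\<Pi>\<^sub>M i\<in>{..<n}. P \<gamma>)"
      using f by (simp cong: measurable_cong_sets sets_PiM_cong)
    show "prob_space (density (P \<gamma>) (\<lambda>x. ennreal (exp (X x))))"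
      unfolding Q[symmetric] by (rule prob_space_P) fact
  qed (use R X aff in \<open>auto simp: prob_space_P assms sqrt_exp Q[symmetric]\<close>)
  have "?H\<^sup>2 \<le> (1 / sqrt n)\<^sup>2"
    using H by (intro power_mono) (auto simp: hellinger_def)
  then have A: "1 + (- 1 / (2 * n)) \<le> A"
    using \<open>1 \<le> n\<close> by (simp add: aff(2) power_divide)
  have n2: "- 1 \<le> - 1 / (2 * real n)" using \<open>1 \<le> n\<close> by (simp add: field_simps)
  have "1 / 2 = 1 + real n * (- 1 / (2 * real n))" using \<open>1 \<le> n\<close> by simp
  also have "\<dots> \<le> (1 + (- 1 / (2 * real n))) ^ n" by (rule Bernoulli_inequality[OF n2])
  also have "\<dots> \<le> A ^ n" using A n2 by (intro power_mono) auto
  finally have "\<bar>s - s'\<bar> * (1 / 2) \<le> \<bar>s - s'\<bar> * A ^ n" by (intro mult_left_mono) auto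
  with le show ?thesis by simp
qed

lemma minimax_risk_ge_modulus:
  assumes "\<Theta> \<subseteq> \<Gamma>" "1 \<le> n"
  shows "ennreal (1 / 4) * hellinger_modulus \<nu> (ef_density d \<nu> \<phi>) T \<Theta> (1 / sqrt n)
    \<le> ennreal_sqrt (minimax_risk \<nu> P T \<Theta> n)"
proof -
  have "ennreal (1 / 4) * ennreal (T \<theta> - T \<theta>') \<le> ennreal_sqrt (minimax_risk \<nu> P T \<Theta> n)"
    if \<theta>: "\<theta> \<in> \<Theta>" "\<theta>' \<in> \<Theta>"
      and H: "hellinger \<nu> (ef_density d \<nu> \<phi> \<theta>) (ef_density d \<nu> \<phi> \<theta>') \<le> 1 / sqrt n" for \<theta> \<theta>'
  proof (cases "T \<theta> \<le> T \<theta>'")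
    case True
    then show ?thesis by (simp add: ennreal_neg)
  next
    case False
    define D where "D = (T \<theta> - T \<theta>') / 4"
    have D: "D > 0" using False by (simp add: D_def)
    have "ennreal (D\<^sup>2) \<le> quad_risk P T \<Theta> n f" if f: "f \<in> borel_measurable (\<Pi>\<^sub>M i\<in>{..<n}. \<nu>)" for f
    \<comment> \<open>An estimator of infinite risk satisfies the bound trivially; otherwise
      \<open>R\<close> bounds its risk at both parameters.\<close>
    proof (cases "quad_risk P T \<Theta> n f")
      case (real R)
      have risk: "(\<integral>\<^sup>+X. ennreal ((f X - T \<eta>)\<^sup>2) \<partial>(\<Pi>\<^sub>M i\<in>{..<n}. P \<eta>)) \<le> ennreal R" if "\<eta> \<in> \<Theta>" for \<eta>
        unfolding real(2)[symmetric] quad_risk_def using that by (intro SUP_upper)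
      have "\<bar>T \<theta> - T \<theta>'\<bar> \<le> 4 * sqrt R"
        using assms \<theta> by (intro quad_risk_lower_bound[OF _ _ assms(2) f H] risk real) auto
      then have "D \<le> sqrt R" by (simp add: D_def)
      then have "D\<^sup>2 \<le> R" using D real(1) by (metis less_imp_le power_mono real_sqrt_pow2)
      then show ?thesis by (simp add: real(2) ennreal_leI)
    qed simp
    then have "ennreal (D\<^sup>2) \<le> minimax_risk \<nu> P T \<Theta> n"
      unfolding minimax_risk_def by (intro INF_greatest)
    from ennreal_sqrt_mono[OF this] have "ennreal D \<le> ennreal_sqrt (minimax_risk \<nu> P T \<Theta> n)"
      using D by (simp add: ennreal_sqrt_power2)
    then show ?thesis by (simp add: D_def ennreal_mult'[symmetric])
  qed
  then show ?thesis
    unfolding hellinger_modulus_def by (subst SUP_mult_left_ennreal) (auto intro!: SUP_least)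
qed

lemma affine_estimator_le_modulus:
  assumes M0: "M0 \<subseteq> mean ` \<Gamma>" and n: "1 \<le> n"
    and conc: "\<And>a. a \<in> Rd d \<Longrightarrow> seq_concave_on M0 (\<lambda>\<mu>. sd (mean_inverse \<mu>) a)"
  shows "\<exists>g\<in>aff_span d \<phi>.
    ennreal_sqrt (quad_risk P (\<lambda>\<gamma>. dot d h (mean \<gamma>)) (mean_inverse ` M0) n (\<lambda>X. (1 / real n) * (\<Sum>i<n. g (X i))))
    \<le> ennreal 4 * hellinger_modulus \<nu> (ef_density d \<nu> \<phi>) (\<lambda>\<gamma>. dot d h (mean \<gamma>)) (mean_inverse ` M0) (1 / sqrt n)"
    (is "\<exists>g\<in>_. ennreal_sqrt (?R g) \<le> ennreal 4 * ?\<omega>")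
proof -
  have aff: "(\<lambda>x. dot d a (\<phi> x) + b) \<in> aff_span d \<phi>" if "a \<in> Rd d" for a b
    unfolding aff_span_def lin_span_def using that
    by (intro CollectI exI[of _ "\<lambda>x. dot d a (\<phi> x)"] exI[of _ b] conjI exI[of _ a]) auto
  have zero: "(\<lambda>x. dot d (\<lambda>_. 0) (\<phi> x) + 0) \<in> aff_span d \<phi>"
    by (rule aff) (simp add: in_Rd_iff)
  \<comment> \<open>In the first two cases the zero estimator serves: the supremum over an empty
    parameter set is 0, or the right-hand side is infinite.\<close>
  consider "M0 = {}" | "M0 \<noteq> {}" "?\<omega> = \<infinity>" | W where "M0 \<noteq> {}" "?\<omega> = ennreal W" "0 \<le> W"
    by (cases ?\<omega>) auto
  then show ?thesis
  proof cases
    case 1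
    have "ennreal_sqrt (?R (\<lambda>x. dot d (\<lambda>_. 0) (\<phi> x) + 0)) = 0"
      by (simp add: 1 quad_risk_def ennreal_sqrt_def bot_ennreal)
    then show ?thesis by (intro bexI[OF _ zero]) simp
  next
    case 2
    then have "ennreal 4 * ?\<omega> = \<infinity>" by (simp add: ennreal_mult_top)
    then show ?thesis by (intro bexI[OF _ zero]) simp
  next
    case 3
    have t: "0 < 1 / sqrt n" using n by simp
    have "dot d h (mean \<theta>) - dot d h (mean \<theta>') \<le> W"
      if "\<theta> \<in> mean_inverse ` M0" "\<theta>' \<in> mean_inverse ` M0"
        "hellinger \<nu> (ef_density d \<nu> \<phi> \<theta>) (ef_density d \<nu> \<phi> \<theta>') \<le> 1 / sqrt n" for \<theta> \<theta>'
    proof -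
      have "ennreal (dot d h (mean \<theta>) - dot d h (mean \<theta>')) \<le> ?\<omega>"
        unfolding hellinger_modulus_def using that by (intro SUP_upper2[of "(\<theta>, \<theta>')"]) auto
      then show ?thesis using 3 by (simp add: ennreal_le_iff)
    qed
    from optimal_affine_functional[OF M0 3(1) conc t this] obtain a b where a: "a \<in> Rd d"
      and ab: "\<And>\<mu>. \<mu> \<in> M0 \<Longrightarrow>
        \<bar>dot d a \<mu> + b - dot d h \<mu>\<bar> + 1 / sqrt n * sd (mean_inverse \<mu>) a \<le> 4 * W"
      by blast
    have "?R (\<lambda>x. dot d a (\<phi> x) + b) \<le> ennreal ((4 * W)\<^sup>2)"
      unfolding quad_risk_def
    proof (intro SUP_least)
      fix \<theta> assume "\<theta> \<in> mean_inverse ` M0"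
      then obtain \<mu> where \<mu>: "\<mu> \<in> M0" "\<theta> = mean_inverse \<mu>" by auto
      then have \<theta>: "\<theta> \<in> \<Gamma>" "mean \<theta> = \<mu>" using mean_inverse[of \<mu>] M0 by auto
      define u v where "u = \<bar>dot d a \<mu> + b - dot d h \<mu>\<bar>" and "v = 1 / sqrt n * sd \<theta> a"
      have uv: "0 \<le> u" "0 \<le> v" "u + v \<le> 4 * W"
        using ab[OF \<mu>(1)] var_dot_nonneg by (auto simp: u_def v_def \<mu>(2))
      have "(dot d a (mean \<theta>) + b - dot d h (mean \<theta>))\<^sup>2 + var_dot \<theta> a / n = u\<^sup>2 + v\<^sup>2"
        using var_dot_nonneg[of \<theta> a] by (simp add: u_def v_def \<theta>(2) power_mult_distrib power_divide)
      \<comment> \<open>The duality controls bias plus standard deviation, and the mean square error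
        is at most the square of that sum.\<close>
      also have "\<dots> \<le> (u + v)\<^sup>2" using uv by (simp add: power2_sum)
      also have "\<dots> \<le> (4 * W)\<^sup>2" using uv by (intro power_mono) auto
      finally show "(\<integral>\<^sup>+X. ennreal (((1 / real n) * (\<Sum>i<n. dot d a (\<phi> (X i)) + b) - dot d h (mean \<theta>))\<^sup>2)
          \<partial>(\<Pi>\<^sub>M i\<in>{..<n}. P \<theta>)) \<le> ennreal ((4 * W)\<^sup>2)"
        unfolding affine_estimator_risk[OF \<theta>(1) n] by (rule ennreal_leI)
    qed
    then have "ennreal_sqrt (?R (\<lambda>x. dot d a (\<phi> x) + b)) \<le> ennreal (4 * W)"
      using ennreal_sqrt_mono ennreal_sqrt_power2[of "4 * W"] 3(3) by fastforce
    also have "\<dots> = ennreal 4 * ?\<omega>" using 3 by (simp add: ennreal_mult)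
    finally show ?thesis by (intro bexI[OF _ aff[OF a, of b]])
  qed
qed

lemma minimax_risk_le_affine_estimator:
  assumes "g \<in> aff_span d \<phi>"
  shows "minimax_risk \<nu> P T \<Theta> n \<le> quad_risk P T \<Theta> n (\<lambda>X. (1 / real n) * (\<Sum>i<n. g (X i)))"
proof -
  obtain a b where g: "g = (\<lambda>x. dot d a (\<phi> x) + b)"
    using assms by (auto simp: aff_span_def lin_span_def)
  have [measurable]: "g \<in> borel_measurable \<nu>" unfolding g by measurable
  show ?thesis unfolding minimax_risk_def by (intro INF_lower) measurable
qed

end

theorem theorem12:
  "\<exists>c0>0. \<exists>c1>0. \<forall>(d::nat) (\<nu>::'a measure) (\<phi>::'a \<Rightarrow> nat \<Rightarrow> real) (\<Gamma>::(nat \<Rightarrow> real) set)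
      (M0::(nat \<Rightarrow> real) set) (h::nat \<Rightarrow> real) (n::nat).
    d \<ge> 1 \<longrightarrow>
    (\<forall>i<d. (\<lambda>x. \<phi> x i) \<in> borel_measurable \<nu>) \<longrightarrow>
    openin (Euclidean_space d) \<Gamma> \<longrightarrow>
    seq_convex \<Gamma> \<longrightarrow>
    (\<forall>\<gamma>\<in>\<Gamma>. partition_fun d \<nu> \<phi> \<gamma> < \<infinity>) \<longrightarrow>
    (\<exists>\<gamma>0\<in>\<Gamma>. \<forall>a\<in>Rd d. a \<noteq> (\<lambda>_. 0) \<longrightarrow>
        prob_space.variance (ef_dist d \<nu> \<phi> \<gamma>0) (\<lambda>x. dot d (\<phi> x) a) > 0) \<longrightarrow>
    M0 \<subseteq> mean_map d \<nu> \<phi> ` \<Gamma> \<longrightarrow>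
    compactin (Euclidean_space d) M0 \<longrightarrow>
    seq_convex M0 \<longrightarrow>
    (\<forall>f\<in>lin_span d \<phi>. seq_concave_on M0
        (\<lambda>\<mu>. sqrt (prob_space.variance (ef_dist d \<nu> \<phi> (mean_inv d \<nu> \<phi> \<Gamma> \<mu>)) f))) \<longrightarrow>
    h \<in> Rd d \<longrightarrow>
    n \<ge> 1 \<longrightarrow>
    (let P = ef_dist d \<nu> \<phi>;
         T = (\<lambda>\<gamma>. dot d h (mean_map d \<nu> \<phi> \<gamma>));
         \<Gamma>0 = mean_inv d \<nu> \<phi> \<Gamma> ` M0;
         \<omega> = hellinger_modulus \<nu> (ef_density d \<nu> \<phi>) T \<Gamma>0 (1 / sqrt (real n))
     in ennreal c0 * \<omega> \<le> ennreal_sqrt (minimax_risk \<nu> P T \<Gamma>0 n) \<and>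
        ennreal_sqrt (minimax_risk \<nu> P T \<Gamma>0 n) \<le> ennreal c1 * \<omega> \<and>
        (\<exists>g\<in>aff_span d \<phi>.
           ennreal_sqrt (quad_risk P T \<Gamma>0 n (\<lambda>X. (1 / real n) * (\<Sum>i<n. g (X i)))) \<le> ennreal c1 * \<omega>))"
\<comment> \<open>The first two goals are positivity of the constants; the third carries the
  theorem.\<close>
proof (rule exI[of _ "1 / 4"], intro conjI exI[of _ "4 :: real"] allI impI, goal_cases)
  case (3 d \<nu> \<phi> \<Gamma> M0 h n)
  then interpret exp_family d \<nu> \<phi> \<Gamma>
    by unfold_locales auto
  have conc: "seq_concave_on M0 (\<lambda>\<mu>. sd (mean_inverse \<mu>) a)" if "a \<in> Rd d" for a
    using 3(10)[rule_format, of "\<lambda>x. dot d a (\<phi> x)"] that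
    unfolding var_dot_def lin_span_def by blast
  have sub: "mean_inverse ` M0 \<subseteq> \<Gamma>" using mean_inverse(1) 3(7) by blast
  obtain g where "g \<in> aff_span d \<phi>"
    "ennreal_sqrt (quad_risk P (\<lambda>\<gamma>. dot d h (mean \<gamma>)) (mean_inverse ` M0) n (\<lambda>X. (1 / real n) * (\<Sum>i<n. g (X i))))
    \<le> ennreal 4 * hellinger_modulus \<nu> (ef_density d \<nu> \<phi>) (\<lambda>\<gamma>. dot d h (mean \<gamma>)) (mean_inverse ` M0) (1 / sqrt n)"
    using affine_estimator_le_modulus[OF 3(7) 3(12) conc] by blast
  then show ?case
    \<comment> \<open>The upper bound on the minimax risk comes from the same estimator
      \<open>g\<close>, whose risk dominates the infimum.\<close>
    unfolding Let_def
    by (intro conjI bexI[of _ g] minimax_risk_ge_modulus[OF sub 3(12)]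
        order_trans[OF ennreal_sqrt_mono[OF minimax_risk_le_affine_estimator]])
qed simp_all

end
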